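(* The map $\widehat{\Theta}:\mathcal{A}\to \mathrm{Mat}_4(\mathcal{A})$ is well defined, that is, the matrices $\widehat{\Theta}(t)$ and $\widehat{\Theta}(r_\hbar)$ commute with $\widehat{\Theta}(a)$ for every $a$ in the subalgebra generated by $x,y,z$ (the enveloping algebra $U(sl(2)_h)=U(su(2)_h)$ over $\mathbb{C}$). Moreover, the map $\widehat{\Theta}$ is compatible with the relation $\mathrm{Cas}=r_\hbar^2-\hbar^2$, i.e. $$\widehat{\Theta}(\mathrm{Cas})=\widehat{\Theta}(r_\hbar)^2-\hbar^2 I .$$
   Context: The ground field is $\mathbb{C}$; $h=2i\hbar$ is a nonzero parameter. $U(u(2)_h)$ is the unital associative algebra generated by $t,x,y,z$ with relations $[x,y]=hz$, $[y,z]=hx$, $[z,x]=hy$, and $t$ central; $U(su(2)_h)$ (denoted also $U(sl(2)_h)$) is the subalgebra generated by $x,y,z$. Put $\mathrm{Cas}=x^2+y^2+z^2$ (a central element). Let $r_\hbar$ ("quantum radius") be a central indeterminate, let $\mathbb{C}(t,r_\hbar)$ be the field of rational functions in $t$ and $r_\hbar$, and let $$\mathcal{A}=\bigl(U(su(2)_h)\otimes\mathbb{C}(t,r_\hbar)\bigr)/\langle x^2+y^2+z^2-r_\hbar^2+\hbar^2\rangle .$$ $\mathrm{Mat}_4(\cdot)$ denotes $4\times 4$ matrices with entries in the given algebra, and $I$ is the identity matrix. The quantum partial derivatives $\partial_t,\partial_x,\partial_y,\partial_z$ are linear operators on $U(u(2)_h)$. They vanish on the unit and satisfy $\partial_u(v)=\delta_{uv}$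 for $u,v\in\{t,x,y,z\}$. With $\tilde\partial_t=\partial_t+\frac{2}{h}\,\mathrm{id}$, they act on products in such a way that $$\widehat{\Theta}=i\hbar\begin{pmatrix}\tilde\partial_t&-\partial_x&-\partial_y&-\partial_z\\ \partial_x&\tilde\partial_t&-\partial_z&\partial_y\\ \partial_y&\partial_z&\tilde\partial_t&-\partial_x\\ \partial_z&-\partial_y&\partial_x&\tilde\partial_t\end{pmatrix}$$ (applied to an element entrywise) is multiplicative: $\widehat{\Theta}(ab)=\widehat{\Theta}(a)\widehat{\Theta}(b)$ and $\widehat{\Theta}(1)=I$. Thus $\widehat{\Theta}$ is the unital algebra homomorphism $U(u(2)_h)\to \mathrm{Mat}_4(U(u(2)_h))$ given on generators by $\widehat{\Theta}(t)=(t+i\hbar)I$ and $$\widehat{\Theta}(x)=\begin{pmatrix}x&-i\hbar&0&0\\ i\hbar&x&0&0\\0&0&x&-i\hbar\\0&0&i\hbar&x\end{pmatrix},\quad \widehat{\Theta}(y)=\begin{pmatrix}y&0&-i\hbar&0\\0&y&0&i\hbar\\ i\hbar&0&y&0\\0&-i\hbar&0&y\end{pmatrix},\quad \widehat{\Theta}(z)=\begin{pmatrix}z&0&0&-i\hbar\\0&z&-i\hbar&0\\0&i\hbar&z&0\\ i\hbar&0&0&z\end{pmatrix}.$$ It is extended to $\mathcal{A}$ multiplicatively by setting $$\widehat{\Theta}(r_\hbar)=\frac{1}{r_\hbar}\begin{pmatrix} r_\hbar^2+\hbar^2&-i\hbar x&-i\hbar y&-i\hbar z\\ i\hbar x&r_\hbar^2+\hbar^2&-i\hbar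 z&i\hbar y\\ i\hbar y&i\hbar z&r_\hbar^2+\hbar^2&-i\hbar x\\ i\hbar z&-i\hbar y&i\hbar x&r_\hbar^2+\hbar^2\end{pmatrix}$$ and $\widehat{\Theta}(f(t,r_\hbar))=f(\widehat{\Theta}(t),\widehat{\Theta}(r_\hbar))$ for $f\in\mathbb{C}(t,r_\hbar)$. *)

theory Defs
  imports
    "HOL-Library.Poly_Mapping"
    "HOL-Computational_Algebra.Fraction_Field"
    "HOL-Computational_Algebra.Polynomial"
    "HOL-Algebra.QuotRing"
    "Jordan_Normal_Form.Matrix"
begin

section \<open>Free algebras\<close>

text \<open>
  Words form an additive monoid under concatenation, so that the multiplication of
  \<open>'a word \<Rightarrow>\<^sub>0 'k\<close> provided by \<open>Poly_Mapping\<close> is that of the free algebra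
  over \<open>'k\<close> on the alphabet \<open>'a\<close>.
\<close>

datatype 'a word = Word (letters: "'a list")

instantiation word :: (type) monoid_add
begin

definition zero_word :: "'a word" where
  "0 = Word []"

definition plus_word :: "'a word \<Rightarrow> 'a word \<Rightarrow> 'a word" where
  "u + v = Word (letters u @ letters v)"

instance
  by standard (simp_all add: zero_word_def plus_word_def)

end

datatype gen = GX | GY | GZ

type_synonym 'k free_alg = "gen word \<Rightarrow>\<^sub>0 'k"

definition fcst :: "'k::field \<Rightarrow> 'k free_alg" where
  "fcst c = Poly_Mapping.single 0 c"

definition fgen :: "gen \<Rightarrow> 'k::field free_alg" where
  "fgen g = Poly_Mapping.single (Word [g]) 1"

definition free_ring :: "'k::field free_alg ring" where
  "free_ring = \<lparr>carrier = UNIV, mult = (*), one = 1, zero = 0, add = (+)\<rparr>"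

text \<open>
  The value of a noncommutative polynomial in a ring \<open>S\<close>, the coefficients being sent to
  \<open>S\<close> by \<open>\<kappa>\<close> and the letters by \<open>\<gamma>\<close>.
\<close>

definition eval_free ::
  "('s, 'm) ring_scheme \<Rightarrow> ('k \<Rightarrow> 's) \<Rightarrow> (gen \<Rightarrow> 's) \<Rightarrow> 'k::field free_alg \<Rightarrow> 's" where
  "eval_free S \<kappa> \<gamma> p =
     (\<Oplus>\<^bsub>S\<^esub>w\<in>Poly_Mapping.keys p.
        \<kappa> (Poly_Mapping.lookup p w) \<otimes>\<^bsub>S\<^esub> foldr (\<lambda>g a. \<gamma> g \<otimes>\<^bsub>S\<^esub> a) (letters w) \<one>\<^bsub>S\<^esub>)"

text \<open>
  The map which \<^const>\<open>eval_free\<close> induces on a quotient of the free algebra; it is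
  meaningful when \<^const>\<open>eval_free\<close> is constant on the cosets.
\<close>

definition induced ::
  "('s, 'm) ring_scheme \<Rightarrow> ('k \<Rightarrow> 's) \<Rightarrow> (gen \<Rightarrow> 's) \<Rightarrow> 'k::field free_alg set \<Rightarrow> 's" where
  "induced S \<kappa> \<gamma> a = the_elem (eval_free S \<kappa> \<gamma> ` a)"


section \<open>The enveloping algebra of \<open>su(2)\<^sub>h\<close>\<close>

text \<open>
  The coefficient field \<open>'k\<close> is kept arbitrary: \<open>'k = \<complex>\<close> gives \<open>U(su(2)\<^sub>h)\<close>, and
  \<open>'k = \<complex>(t, r)\<close> gives its scalar extension \<open>U(su(2)\<^sub>h) \<otimes> \<complex>(t, r)\<close>.
\<close>

definition env_relations :: "'k::field \<Rightarrow> 'k free_alg set" where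
  "env_relations h =
     {fgen GX * fgen GY - fgen GY * fgen GX - fcst h * fgen GZ,
      fgen GY * fgen GZ - fgen GZ * fgen GY - fcst h * fgen GX,
      fgen GZ * fgen GX - fgen GX * fgen GZ - fcst h * fgen GY}"

definition env_ideal :: "'k::field \<Rightarrow> 'k free_alg set" where
  "env_ideal h = Idl\<^bsub>free_ring\<^esub> (env_relations h)"

definition env :: "'k::field \<Rightarrow> 'k free_alg set ring" where
  "env h = free_ring Quot (env_ideal h)"

definition env_cst :: "'k::field \<Rightarrow> 'k \<Rightarrow> 'k free_alg set" where
  "env_cst h c = env_ideal h +>\<^bsub>free_ring\<^esub> fcst c"

definition env_gen :: "'k::field \<Rightarrow> gen \<Rightarrow> 'k free_alg set" where
  "env_gen h g = env_ideal h +>\<^bsub>free_ring\<^esub> fgen g"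

definition env_cas :: "'k::field \<Rightarrow> 'k free_alg set" where
  "env_cas h =
     env_gen h GX [^]\<^bsub>env h\<^esub> (2::nat) \<oplus>\<^bsub>env h\<^esub> env_gen h GY [^]\<^bsub>env h\<^esub> (2::nat)
       \<oplus>\<^bsub>env h\<^esub> env_gen h GZ [^]\<^bsub>env h\<^esub> (2::nat)"


section \<open>The algebra \<open>\<A>\<close>\<close>

text \<open>
  \<open>\<complex>(t, r)\<close> is the fraction field of \<open>\<complex>[t][r]\<close>: the outer polynomial variable is \<open>r\<close>,
  the inner one is \<open>t\<close>.
\<close>

type_synonym ratfun = "complex poly poly fract"

definition rf_cst :: "complex \<Rightarrow> ratfun" where
  "rf_cst c = Fraction_Field.Fract [:[:c:]:] 1"

definition rf_t :: ratfun where
  "rf_t = Fraction_Field.Fract [:[:0, 1:]:] 1"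

definition rf_r :: ratfun where
  "rf_r = Fraction_Field.Fract [:0, 1:] 1"

definition planck :: "complex \<Rightarrow> complex" where
  "planck hbar = 2 * \<i> * hbar"

abbreviation U_su2 :: "complex \<Rightarrow> complex free_alg set ring" where
  "U_su2 hbar \<equiv> env (planck hbar)"

abbreviation U_su2_ext :: "complex \<Rightarrow> ratfun free_alg set ring" where
  "U_su2_ext hbar \<equiv> env (rf_cst (planck hbar))"

definition cas_ideal :: "complex \<Rightarrow> ratfun free_alg set set" where
  "cas_ideal hbar =
     (let h = rf_cst (planck hbar) in
      Idl\<^bsub>U_su2_ext hbar\<^esub>
        {env_cas h \<ominus>\<^bsub>U_su2_ext hbar\<^esub> env_cst h (rf_r ^ 2)
           \<oplus>\<^bsub>U_su2_ext hbar\<^esub> env_cst h (rf_cst (hbar ^ 2))})"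

definition qalg :: "complex \<Rightarrow> ratfun free_alg set set ring" where
  "qalg hbar = U_su2_ext hbar Quot cas_ideal hbar"

definition q_cst :: "complex \<Rightarrow> ratfun \<Rightarrow> ratfun free_alg set set" where
  "q_cst hbar f = cas_ideal hbar +>\<^bsub>U_su2_ext hbar\<^esub> env_cst (rf_cst (planck hbar)) f"

definition q_gen :: "complex \<Rightarrow> gen \<Rightarrow> ratfun free_alg set set" where
  "q_gen hbar g = cas_ideal hbar +>\<^bsub>U_su2_ext hbar\<^esub> env_gen (rf_cst (planck hbar)) g"

text \<open>The canonical map \<open>U(su(2)\<^sub>h) \<rightarrow> \<A>\<close>.\<close>

definition q_incl :: "complex \<Rightarrow> complex free_alg set \<Rightarrow> ratfun free_alg set set" where
  "q_incl hbar = induced (qalg hbar) (\<lambda>c. q_cst hbar (rf_cst c)) (q_gen hbar)"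


section \<open>Matrices over a ring\<close>

definition mat_alg :: "nat \<Rightarrow> ('a, 'm) ring_scheme \<Rightarrow> 'a mat ring" where
  "mat_alg n R =
     \<lparr>carrier = {M \<in> carrier_mat n n. \<forall>i<n. \<forall>j<n. M $$ (i, j) \<in> carrier R},
      mult = (\<lambda>M N. mat n n (\<lambda>(i, j). \<Oplus>\<^bsub>R\<^esub>k\<in>{..<n}. M $$ (i, k) \<otimes>\<^bsub>R\<^esub> N $$ (k, j))),
      one = mat n n (\<lambda>(i, j). if i = j then \<one>\<^bsub>R\<^esub> else \<zero>\<^bsub>R\<^esub>),
      zero = mat n n (\<lambda>(i, j). \<zero>\<^bsub>R\<^esub>),
      add = (\<lambda>M N. mat n n (\<lambda>(i, j). M $$ (i, j) \<oplus>\<^bsub>R\<^esub> N $$ (i, j)))\<rparr>"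

definition scalar_mat :: "nat \<Rightarrow> ('a, 'm) ring_scheme \<Rightarrow> 'a \<Rightarrow> 'a mat" where
  "scalar_mat n R a = mat n n (\<lambda>(i, j). if i = j then a else \<zero>\<^bsub>R\<^esub>)"

abbreviation Mat4 :: "complex \<Rightarrow> ratfun free_alg set set mat ring" where
  "Mat4 hbar \<equiv> mat_alg 4 (qalg hbar)"

definition m_cst :: "complex \<Rightarrow> complex \<Rightarrow> ratfun free_alg set set mat" where
  "m_cst hbar c = scalar_mat 4 (qalg hbar) (q_cst hbar (rf_cst c))"


section \<open>The values of \<open>\<Theta>\<close>\<close>

definition Theta_gen :: "complex \<Rightarrow> gen \<Rightarrow> ratfun free_alg set set mat" where
  "Theta_gen hbar g =
     (let o' = \<zero>\<^bsub>qalg hbar\<^esub>;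
          p = q_cst hbar (rf_cst (\<i> * hbar));
          m = q_cst hbar (rf_cst (- \<i> * hbar));
          x = q_gen hbar GX; y = q_gen hbar GY; z = q_gen hbar GZ
      in case g of
        GX \<Rightarrow> mat_of_rows_list 4
          [[x,  m,  o', o'],
           [p,  x,  o', o'],
           [o', o', x,  m ],
           [o', o', p,  x ]]
      | GY \<Rightarrow> mat_of_rows_list 4
          [[y,  o', m,  o'],
           [o', y,  o', p ],
           [p,  o', y,  o'],
           [o', m,  o', y ]]
      | GZ \<Rightarrow> mat_of_rows_list 4
          [[z,  o', o', m ],
           [o', z,  m,  o'],
           [o', p,  z,  o'],
           [p,  o', o', z ]])"

definition Theta_t :: "complex \<Rightarrow> ratfun free_alg set set mat" where
  "Theta_t hbar = scalar_mat 4 (qalg hbar) (q_cst hbar (rf_t + rf_cst (\<i> * hbar)))"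

definition Theta_r :: "complex \<Rightarrow> ratfun free_alg set set mat" where
  "Theta_r hbar =
     (let d = q_cst hbar (rf_r ^ 2 + rf_cst (hbar ^ 2));
          p = (\<lambda>g. q_cst hbar (rf_cst (\<i> * hbar)) \<otimes>\<^bsub>qalg hbar\<^esub> q_gen hbar g);
          m = (\<lambda>g. q_cst hbar (rf_cst (- \<i> * hbar)) \<otimes>\<^bsub>qalg hbar\<^esub> q_gen hbar g)
      in map_mat (\<lambda>a. q_cst hbar (1 / rf_r) \<otimes>\<^bsub>qalg hbar\<^esub> a)
        (mat_of_rows_list 4
          [[d,    m GX, m GY, m GZ],
           [p GX, d,    m GZ, p GY],
           [p GY, p GZ, d,    m GX],
           [p GZ, m GY, p GX, d   ]]))"

text \<open>The map \<open>\<Theta>\<close> on \<open>U(su(2)\<^sub>h)\<close>, before its extension to \<open>\<A>\<close>.\<close>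

definition Theta_U :: "complex \<Rightarrow> complex free_alg set \<Rightarrow> ratfun free_alg set set mat" where
  "Theta_U hbar = induced (Mat4 hbar) (m_cst hbar) (Theta_gen hbar)"

text \<open>The substitution of \<open>\<Theta>(t)\<close> and \<open>\<Theta>(r)\<close> for \<open>t\<close> and \<open>r\<close> in a polynomial.\<close>

definition Theta_subst :: "complex \<Rightarrow> complex poly poly \<Rightarrow> ratfun free_alg set set mat" where
  "Theta_subst hbar p =
     (\<Oplus>\<^bsub>Mat4 hbar\<^esub>j\<in>{..Polynomial.degree p}.
        (\<Oplus>\<^bsub>Mat4 hbar\<^esub>i\<in>{..Polynomial.degree (Polynomial.coeff p j)}.
           m_cst hbar (Polynomial.coeff (Polynomial.coeff p j) i)
             \<otimes>\<^bsub>Mat4 hbar\<^esub> Theta_t hbar [^]\<^bsub>Mat4 hbar\<^esub> i \<otimes>\<^bsub>Mat4 hbar\<^esub> Theta_r hbar [^]\<^bsub>Mat4 hbar\<^esub> j))"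

text \<open>
  \<open>\<Theta>\<close> is a multiplicative extension of \<^const>\<open>Theta_U\<close> to \<open>\<A>\<close> with
  \<open>\<Theta>(f(t, r)) = f(\<Theta>(t), \<Theta>(r))\<close>; for \<open>f = p / q\<close> the right-hand side is
  \<open>p(\<Theta>(t), \<Theta>(r)) q(\<Theta>(t), \<Theta>(r))\<inverse>\<close>, which presupposes that the denominator is invertible.
\<close>

definition is_Theta ::
  "complex \<Rightarrow> (ratfun free_alg set set \<Rightarrow> ratfun free_alg set set mat) \<Rightarrow> bool" where
  "is_Theta hbar \<Theta> \<longleftrightarrow>
     \<Theta> \<in> Ring.ring_hom (qalg hbar) (Mat4 hbar) \<and>
     (\<forall>a \<in> carrier (U_su2 hbar). \<Theta> (q_incl hbar a) = Theta_U hbar a) \<and>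
     (\<forall>g. \<Theta> (q_gen hbar g) = Theta_gen hbar g) \<and>
     \<Theta> (q_cst hbar rf_t) = Theta_t hbar \<and>
     \<Theta> (q_cst hbar rf_r) = Theta_r hbar \<and>
     (\<forall>p q. q \<noteq> 0 \<longrightarrow>
        Theta_subst hbar q \<in> Units (Mat4 hbar) \<and>
        \<Theta> (q_cst hbar (Fraction_Field.Fract p q)) =
          Theta_subst hbar p \<otimes>\<^bsub>Mat4 hbar\<^esub> inv\<^bsub>Mat4 hbar\<^esub> (Theta_subst hbar q))"

end

theory Submission
  imports Defs
begin

text \<open>
  Write \<open>\<Theta>(g) = x\<^sub>g + d\<^sub>g\<close>, where \<open>d\<^sub>g\<close> is \<open>i\<hbar>\<close> times the left multiplication by a quaternion
  unit. Both \<open>x\<close> and \<open>d\<close> satisfy the relations of \<open>su(2)\<^sub>h\<close> and they commute with each other,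
  so \<open>x + d\<close> satisfies them too, and \<open>N = \<Sum>\<^sub>g x\<^sub>g d\<^sub>g\<close> commutes with \<open>x + d\<close>. From
  \<open>N\<^sup>2 = \<hbar>\<^sup>2 (r\<^sup>2 - \<hbar>\<^sup>2) - 2\<hbar>\<^sup>2 N\<close> one gets \<open>(N + \<hbar>\<^sup>2)\<^sup>2 = \<hbar>\<^sup>2 r\<^sup>2\<close>, hence
  \<open>\<Theta>(r) = r + \<hbar> J\<close> with an involution \<open>J\<close> which commutes with all \<open>\<Theta>(g)\<close>. Therefore
  substituting \<open>\<Theta>(t)\<close>, \<open>\<Theta>(r)\<close> into a rational function \<open>f\<close> amounts to
  \<open>f(t + i\<hbar>, r + \<hbar>) (1 + J) / 2 + f(t + i\<hbar>, r - \<hbar>) (1 - J) / 2\<close>. This is a ring homomorphism,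
  and no nonzero denominator is killed, because the two shifts are automorphisms of \<open>\<complex>(t, r)\<close>.
\<close>

section \<open>Evaluation of noncommutative polynomials\<close>

lemma ring_free_ring: "ring (free_ring :: 'k::field free_alg ring)"
proof (rule ringI)
  show "abelian_group (free_ring :: 'k free_alg ring)"
  proof (rule abelian_groupI)
    fix x :: "'k free_alg"
    show "\<exists>y\<in>carrier free_ring. y \<oplus>\<^bsub>free_ring\<^esub> x = \<zero>\<^bsub>free_ring\<^esub>"
      by (rule bexI[of _ "- x"]) (simp_all add: free_ring_def)
  qed (simp_all add: free_ring_def add.assoc add.commute)
  show "Group.monoid (free_ring :: 'k free_alg ring)"
    by unfold_locales (simp_all add: free_ring_def mult.assoc)
qed (simp_all add: free_ring_def distrib_left distrib_right)

lemma free_ring_simps [simp]: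
  "carrier free_ring = UNIV" "mult free_ring = (*)" "one free_ring = 1"
  "zero free_ring = 0" "add free_ring = (+)"
  by (simp_all add: free_ring_def)

interpretation free_ring: ring "free_ring :: 'k::field free_alg ring"
  by (rule ring_free_ring)

lemma free_ring_a_inv [simp]: "\<ominus>\<^bsub>free_ring\<^esub> x = - (x :: 'k::field free_alg)"
  using free_ring.minus_equality[of "- x" x] by simp

lemma free_ring_a_minus [simp]: "x \<ominus>\<^bsub>free_ring\<^esub> y = x - (y :: 'k::field free_alg)"
  by (simp add: a_minus_def)

lemma fcst_add: "fcst (a + b) = fcst a + fcst b"
  by (simp add: fcst_def single_add)

lemma fcst_mult: "fcst (a * b) = fcst a * fcst b"
  by (simp add: fcst_def mult_single)

lemma fcst_1 [simp]: "fcst 1 = 1"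
  by (simp add: fcst_def)

lemma poly_mapping_eq_sum_single:
  fixes f :: "'a \<Rightarrow>\<^sub>0 'b::comm_monoid_add"
  shows "f = (\<Sum>k\<in>Poly_Mapping.keys f. Poly_Mapping.single k (Poly_Mapping.lookup f k))"
  by (rule poly_mapping_eqI)
     (auto simp: lookup_sum lookup_single when_def in_keys_iff sum.delta)

lemma poly_mapping_single_add_induct [case_names single add]:
  fixes f :: "'a \<Rightarrow>\<^sub>0 'b::comm_monoid_add"
  assumes single: "\<And>k c. P (Poly_Mapping.single k c)"
    and add: "\<And>f g. P f \<Longrightarrow> P g \<Longrightarrow> P (f + g)"
  shows "P f"
proof -
  have "P (\<Sum>k\<in>A. Poly_Mapping.single k (Poly_Mapping.lookup f k))" if "finite A" for A
    using that
  proof induction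
    case empty
    \<comment> \<open>Zero is a monomial with coefficient 0 at an arbitrary key, so the empty sum
      falls under \<open>single\<close>.\<close>
    show ?case using single[of undefined 0] by simp
  qed (simp add: single add)
  then show ?thesis
    by (subst poly_mapping_eq_sum_single) simp
qed

lemma single_Word_Cons:
  "Poly_Mapping.single (Word (g # gs)) c = fgen g * Poly_Mapping.single (Word gs) c"
  by (simp add: fgen_def mult_single plus_word_def)

text \<open>Peeling letters off a word with \<open>single_Word_Cons\<close> ends at a scalar, so
  scalars and letters generate the free algebra. Centrality of scalars and the uniqueness of
  homomorphisms both rest on this rule.\<close>

lemma free_alg_induct [case_names fcst fgen add mult]:
  fixes p :: "'k::field free_alg"
  assumes fcst: "\<And>c. P (fcst c)" and fgen: "\<And>g. P (fgen g)"
    and add: "\<And>p q. P p \<Longrightarrow> P q \<Longrightarrow> P (p + q)" and mult: "\<And>p q. P p \<Longrightarrow> P q \<Longrightarrow> P (p * q)"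
  shows "P p"
proof (induction p rule: poly_mapping_single_add_induct)
  case (single w c)
  have "P (Poly_Mapping.single (Word gs) c)" for gs
  proof (induction gs)
    case Nil
    show ?case using fcst[of c] by (simp add: fcst_def zero_word_def)
  next
    case (Cons g gs)
    then show ?case by (simp add: single_Word_Cons fgen mult)
  qed
  then show ?case by (cases w) simp
qed (rule add)

lemma fcst_commute: "fcst c * p = p * fcst c"
proof (induction p rule: free_alg_induct)
  case (fcst d)
  show ?case by (simp add: fcst_def mult_single mult.commute)
next
  case (fgen g)
  show ?case by (simp add: fcst_def fgen_def mult_single)
next
  case (add p q)
  then show ?case by (simp add: algebra_simps)
next
  case (mult p q)
  then show ?case by (metis mult.assoc)
qed

lemma (in ring_hom_ring) hom_a_minus [simp]:
  "x \<in> carrier R \<Longrightarrow> y \<in> carrier R \<Longrightarrow> h (x \<ominus>\<^bsub>R\<^esub> y) = h x \<ominus>\<^bsub>S\<^esub> h y"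
  by (simp add: R.minus_eq S.minus_eq)

text \<open>The images of coefficients are asked to commute with the images of letters only, not to
  be central in \<open>S\<close>. This generality is essential: the extended \<Theta> sends rational
  functions to matrices that are in general neither scalar nor central.\<close>

locale free_eval = ring S for S :: "('s, 'm) ring_scheme" (structure) +
  fixes \<kappa> :: "'k::field \<Rightarrow> 's" and \<gamma> :: "gen \<Rightarrow> 's"
  assumes \<kappa>_closed [simp, intro]: "\<kappa> c \<in> carrier S"
    and \<kappa>_add: "\<kappa> (c + d) = \<kappa> c \<oplus> \<kappa> d"
    and \<kappa>_mult: "\<kappa> (c * d) = \<kappa> c \<otimes> \<kappa> d"
    and \<kappa>_1 [simp]: "\<kappa> 1 = \<one>"
    and \<gamma>_closed [simp, intro]: "\<gamma> g \<in> carrier S"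
    and \<kappa>_\<gamma>_commute: "\<kappa> c \<otimes> \<gamma> g = \<gamma> g \<otimes> \<kappa> c"
begin

lemma \<kappa>_0 [simp]: "\<kappa> 0 = \<zero>"
  using \<kappa>_add[of 0 0] \<kappa>_closed[of 0] by (metis add.r_cancel_one' add_0)

lemma \<kappa>_sum: "\<kappa> (\<Sum>i\<in>A. f i) = (\<Oplus>i\<in>A. \<kappa> (f i))"
  by (induction A rule: infinite_finite_induct) (simp_all add: \<kappa>_add)

lemma \<kappa>_pow: "\<kappa> (c ^ n) = \<kappa> c [^] n"
  by (induction n) (simp_all add: power_Suc2 \<kappa>_mult del: power_Suc)

definition mon :: "gen list \<Rightarrow> 's" where
  "mon gs = foldr (\<lambda>g a. \<gamma> g \<otimes> a) gs \<one>"

lemma mon_Nil [simp]: "mon [] = \<one>"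
  by (simp add: mon_def)

lemma mon_Cons [simp]: "mon (g # gs) = \<gamma> g \<otimes> mon gs"
  by (simp add: mon_def)

lemma mon_closed [simp, intro]: "mon gs \<in> carrier S"
  by (induction gs) simp_all

lemma mon_append: "mon (gs @ hs) = mon gs \<otimes> mon hs"
  by (induction gs) (simp_all add: m_assoc)

lemma \<kappa>_mon_commute: "\<kappa> c \<otimes> mon gs = mon gs \<otimes> \<kappa> c"
proof (induction gs)
  case (Cons g gs)
  have "\<kappa> c \<otimes> mon (g # gs) = \<gamma> g \<otimes> (\<kappa> c \<otimes> mon gs)"
    by (simp add: m_assoc[symmetric] \<kappa>_\<gamma>_commute)
  then show ?case by (simp add: Cons m_assoc)
qed simp

abbreviation ev :: "'k free_alg \<Rightarrow> 's" where
  "ev \<equiv> eval_free S \<kappa> \<gamma>"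

text \<open>A vanishing coefficient contributes nothing because \<open>\<kappa> 0\<close> is zero.
  Additivity needs a common index set, since cancellation can shrink the support of a sum.\<close>

lemma ev_superset:
  assumes "finite A" "Poly_Mapping.keys p \<subseteq> A"
  shows "ev p = (\<Oplus>w\<in>A. \<kappa> (Poly_Mapping.lookup p w) \<otimes> mon (letters w))"
  unfolding eval_free_def mon_def[symmetric]
  by (rule add.finprod_mono_neutral_cong_left) (use assms in \<open>auto simp: in_keys_iff\<close>)

lemma ev_closed [simp, intro]: "ev p \<in> carrier S"
  by (subst ev_superset[OF finite_keys order_refl]) auto

lemma ev_add: "ev (p + q) = ev p \<oplus> ev q"
proof -
  let ?A = "Poly_Mapping.keys p \<union> Poly_Mapping.keys q"
  have "ev (p + q) = (\<Oplus>w\<in>?A. \<kappa> (Poly_Mapping.lookup (p + q) w) \<otimes> mon (letters w))"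
    by (rule ev_superset) (auto simp: Poly_Mapping.keys_add)
  also have "\<dots> = (\<Oplus>w\<in>?A. \<kappa> (Poly_Mapping.lookup p w) \<otimes> mon (letters w) \<oplus>
      \<kappa> (Poly_Mapping.lookup q w) \<otimes> mon (letters w))"
  proof (rule finsum_cong'[OF refl])
    fix w
    show "\<kappa> (Poly_Mapping.lookup (p + q) w) \<otimes> mon (letters w) =
        \<kappa> (Poly_Mapping.lookup p w) \<otimes> mon (letters w) \<oplus>
        \<kappa> (Poly_Mapping.lookup q w) \<otimes> mon (letters w)"
      unfolding lookup_add \<kappa>_add by (rule l_distr) simp_all
  qed simp
  also have "\<dots> = (\<Oplus>w\<in>?A. \<kappa> (Poly_Mapping.lookup p w) \<otimes> mon (letters w)) \<oplus>
      (\<Oplus>w\<in>?A. \<kappa> (Poly_Mapping.lookup q w) \<otimes> mon (letters w))"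
    by (rule finsum_addf) auto
  also have "\<dots> = ev p \<oplus> ev q"
    by (simp add: ev_superset[of ?A p] ev_superset[of ?A q])
  finally show ?thesis .
qed

lemma ev_single: "ev (Poly_Mapping.single (Word gs) c) = \<kappa> c \<otimes> mon gs"
  by (subst ev_superset[of "{Word gs}"]) auto

text \<open>Both sides are biadditive, so monomials suffice; there the scalar of the right factor is
  moved across the word of the left one.\<close>

lemma ev_mult: "ev (p * q) = ev p \<otimes> ev q"
proof (induction p rule: poly_mapping_single_add_induct)
  case (single v c)
  show ?case
  proof (induction q rule: poly_mapping_single_add_induct)
    case (single w d)
    obtain gs hs where vw: "v = Word gs" "w = Word hs" by (metis word.exhaust)
    have "\<kappa> c \<otimes> \<kappa> d \<otimes> (mon gs \<otimes> mon hs) = \<kappa> c \<otimes> (\<kappa> d \<otimes> mon gs) \<otimes> mon hs"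
      by (simp add: m_assoc)
    also have "\<dots> = \<kappa> c \<otimes> mon gs \<otimes> (\<kappa> d \<otimes> mon hs)"
      unfolding \<kappa>_mon_commute[of d gs] by (simp add: m_assoc)
    finally show ?case
      by (simp add: vw mult_single plus_word_def ev_single \<kappa>_mult mon_append)
  qed (simp add: distrib_left ev_add r_distr)
qed (simp add: distrib_right ev_add l_distr)

lemma ev_fcst [simp]: "ev (fcst c) = \<kappa> c"
  using ev_single[of "[]" c] by (simp add: fcst_def zero_word_def)

lemma ev_fgen [simp]: "ev (fgen g) = \<gamma> g"
  using ev_single[of "[g]" 1] by (simp add: fgen_def)

lemma ev_ring_hom: "ev \<in> Ring.ring_hom free_ring S"
  by (rule ring_hom_memI) (auto simp: ev_add ev_mult ev_fcst[of 1, simplified])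

end

lemma ring_hom_free_eqI:
  fixes f g :: "'k::field free_alg \<Rightarrow> 's"
  assumes "f \<in> Ring.ring_hom free_ring S" "g \<in> Ring.ring_hom free_ring S"
    and "\<And>c. f (fcst c) = g (fcst c)" "\<And>i. f (fgen i) = g (fgen i)"
  shows "f p = g p"
proof (induction p rule: free_alg_induct)
  case (add p q)
  then show ?case
    using ring_hom_add[OF assms(1), of p q] ring_hom_add[OF assms(2), of p q] by simp
next
  case (mult p q)
  then show ?case
    using ring_hom_mult[OF assms(1), of p q] ring_hom_mult[OF assms(2), of p q] by simp
qed (rule assms)+

section \<open>Homomorphisms induced on quotient rings\<close>

lemma (in ideal) quot_carrier: "carrier (R Quot I) = (+>) I ` carrier R"
  by (auto simp: FactRing_def A_RCOSETS_def')

lemma (in ideal) quot_eq_zero: "a \<in> I \<Longrightarrow> I +> a = \<zero>\<^bsub>R Quot I\<^esub>"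
  using a_rcos_const by (simp add: FactRing_def)

text \<open>As \<open>h\<close> kills \<open>I\<close>, it is constant on each coset; the image of a
  coset is a singleton, and \<open>the_elem\<close> extracts its value. This is the same encoding as
  in \<open>induced\<close>.\<close>

locale quot_hom = ideal I R + ring_hom_ring R S h for I R S h +
  assumes h_ideal: "a \<in> I \<Longrightarrow> h a = \<zero>\<^bsub>S\<^esub>"
begin

lemma the_elem_coset:
  assumes "x \<in> carrier R"
  shows "the_elem (h ` (I +>\<^bsub>R\<^esub> x)) = h x"
proof -
  have "h ` (I +>\<^bsub>R\<^esub> x) = {h x}"
  proof (intro equalityI subsetI)
    fix y assume "y \<in> h ` (I +>\<^bsub>R\<^esub> x)"
    then obtain a where "a \<in> I" "y = h (a \<oplus>\<^bsub>R\<^esub> x)"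
      by (auto simp: a_r_coset_def')
    with assms show "y \<in> {h x}"
      by (simp add: h_ideal a_Hcarr)
  next
    fix y assume "y \<in> {h x}"
    then show "y \<in> h ` (I +>\<^bsub>R\<^esub> x)"
      using a_rcos_self[OF assms] by blast
  qed
  then show ?thesis by simp
qed

lemma quot_ring_hom: "(\<lambda>A. the_elem (h ` A)) \<in> Ring.ring_hom (R Quot I) S"
proof (rule ring_hom_memI)
  fix A assume "A \<in> carrier (R Quot I)"
  then obtain x where x: "x \<in> carrier R" "A = I +>\<^bsub>R\<^esub> x"
    by (auto simp: quot_carrier)
  then show "the_elem (h ` A) \<in> carrier S"
    by (simp add: the_elem_coset)
  fix B assume "B \<in> carrier (R Quot I)"
  then obtain y where y: "y \<in> carrier R" "B = I +>\<^bsub>R\<^esub> y"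
    by (auto simp: quot_carrier)
  have q: "(I +>\<^bsub>R\<^esub> x) \<otimes>\<^bsub>R Quot I\<^esub> (I +>\<^bsub>R\<^esub> y) = I +>\<^bsub>R\<^esub> (x \<otimes>\<^bsub>R\<^esub> y)"
    "(I +>\<^bsub>R\<^esub> x) \<oplus>\<^bsub>R Quot I\<^esub> (I +>\<^bsub>R\<^esub> y) = I +>\<^bsub>R\<^esub> (x \<oplus>\<^bsub>R\<^esub> y)"
    using ring_hom_mult[OF rcos_ring_hom] ring_hom_add[OF rcos_ring_hom] x y by simp_all
  show "the_elem (h ` (A \<otimes>\<^bsub>R Quot I\<^esub> B)) = the_elem (h ` A) \<otimes>\<^bsub>S\<^esub> the_elem (h ` B)"
    "the_elem (h ` (A \<oplus>\<^bsub>R Quot I\<^esub> B)) = the_elem (h ` A) \<oplus>\<^bsub>S\<^esub> the_elem (h ` B)"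
    using x y by (simp_all add: q the_elem_coset)
next
  have "\<one>\<^bsub>R Quot I\<^esub> = I +>\<^bsub>R\<^esub> \<one>\<^bsub>R\<^esub>"
    using ring_hom_one[OF rcos_ring_hom] by simp
  then show "the_elem (h ` \<one>\<^bsub>R Quot I\<^esub>) = \<one>\<^bsub>S\<^esub>"
    by (simp add: the_elem_coset)
qed

end

text \<open>The kernel is an ideal, so it contains the generated ideal as soon as it contains the
  generators.\<close>

lemma quot_hom_Idl:
  assumes "ring_hom_ring R S h" "G \<subseteq> carrier R" "\<And>g. g \<in> G \<Longrightarrow> h g = \<zero>\<^bsub>S\<^esub>"
  shows "quot_hom (Idl\<^bsub>R\<^esub> G) R S h"
proof -
  interpret ring_hom_ring R S h by fact
  have "G \<subseteq> a_kernel R S h"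
    unfolding a_kernel_def' using assms(2,3) by blast
  then have "Idl\<^bsub>R\<^esub> G \<subseteq> a_kernel R S h"
    by (rule R.genideal_minimal[OF kernel_is_ideal])
  then have "h a = \<zero>\<^bsub>S\<^esub>" if "a \<in> Idl\<^bsub>R\<^esub> G" for a
    using that unfolding a_kernel_def' by blast
  then show ?thesis
    by (intro quot_hom.intro R.genideal_ideal quot_hom_axioms.intro assms(1,2))
qed

section \<open>Matrix rings and quaternion units\<close>

text \<open>Needed for the associativity of the matrix product.\<close>

lemma (in abelian_monoid) finsum_swap:
  assumes "finite A" "finite B" "\<And>i j. i \<in> A \<Longrightarrow> j \<in> B \<Longrightarrow> f i j \<in> carrier G"
  shows "(\<Oplus>i\<in>A. \<Oplus>j\<in>B. f i j) = (\<Oplus>j\<in>B. \<Oplus>i\<in>A. f i j)"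
  using assms(1,3)
proof (induction A)
  case (insert a A)
  have "(\<Oplus>i\<in>insert a A. \<Oplus>j\<in>B. f i j) = (\<Oplus>j\<in>B. f a j) \<oplus> (\<Oplus>i\<in>A. \<Oplus>j\<in>B. f i j)"
    using insert by (intro finsum_insert) (auto intro!: finsum_closed)
  also have "\<dots> = (\<Oplus>j\<in>B. f a j) \<oplus> (\<Oplus>j\<in>B. \<Oplus>i\<in>A. f i j)"
    using insert by simp
  also have "\<dots> = (\<Oplus>j\<in>B. f a j \<oplus> (\<Oplus>i\<in>A. f i j))"
    using insert by (intro finsum_addf[symmetric]) (auto intro!: finsum_closed)
  also have "\<dots> = (\<Oplus>j\<in>B. \<Oplus>i\<in>insert a A. f i j)"
    using insert by (intro finsum_cong' refl finsum_insert[symmetric]) (auto intro!: finsum_closed)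
  finally show ?case .
qed simp

lemma less_4_cases: "i < (4::nat) \<Longrightarrow> (i = 0 \<Longrightarrow> P) \<Longrightarrow> (i = 1 \<Longrightarrow> P) \<Longrightarrow> (i = 2 \<Longrightarrow> P) \<Longrightarrow> (i = 3 \<Longrightarrow> P) \<Longrightarrow> P"
  by linarith

context ring
begin

lemma mat_alg_carrier:
  "M \<in> carrier (mat_alg n R) \<longleftrightarrow> M \<in> carrier_mat n n \<and> (\<forall>i<n. \<forall>j<n. M $$ (i, j) \<in> carrier R)"
  by (simp add: mat_alg_def)

lemma mat_alg_eqI:
  assumes "M \<in> carrier (mat_alg n R)" "N \<in> carrier (mat_alg n R)"
    and "\<And>i j. i < n \<Longrightarrow> j < n \<Longrightarrow> M $$ (i, j) = N $$ (i, j)"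
  shows "M = N"
  using assms by (intro eq_matI) (auto simp: mat_alg_carrier)

lemma mat_alg_closed [simp]:
  "M \<in> carrier (mat_alg n R) \<Longrightarrow> N \<in> carrier (mat_alg n R) \<Longrightarrow>
    M \<otimes>\<^bsub>mat_alg n R\<^esub> N \<in> carrier (mat_alg n R)"
  "M \<in> carrier (mat_alg n R) \<Longrightarrow> N \<in> carrier (mat_alg n R) \<Longrightarrow>
    M \<oplus>\<^bsub>mat_alg n R\<^esub> N \<in> carrier (mat_alg n R)"
  "\<one>\<^bsub>mat_alg n R\<^esub> \<in> carrier (mat_alg n R)"
  "\<zero>\<^bsub>mat_alg n R\<^esub> \<in> carrier (mat_alg n R)"
  unfolding mat_alg_carrier by (auto simp: mat_alg_def intro!: finsum_closed)

lemma mat_alg_index [simp]: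
  assumes "i < n" "j < n"
  shows "(M \<otimes>\<^bsub>mat_alg n R\<^esub> N) $$ (i, j) = (\<Oplus>k\<in>{..<n}. M $$ (i, k) \<otimes> N $$ (k, j))"
    "(M \<oplus>\<^bsub>mat_alg n R\<^esub> N) $$ (i, j) = M $$ (i, j) \<oplus> N $$ (i, j)"
    "\<one>\<^bsub>mat_alg n R\<^esub> $$ (i, j) = (if i = j then \<one> else \<zero>)"
    "\<zero>\<^bsub>mat_alg n R\<^esub> $$ (i, j) = \<zero>"
  using assms by (simp_all add: mat_alg_def)

lemma scalar_mat_one: "scalar_mat n R \<one> = \<one>\<^bsub>mat_alg n R\<^esub>"
  by (simp add: scalar_mat_def mat_alg_def)

lemma mat_alg_entry_closed [simp]:
  "M \<in> carrier (mat_alg n R) \<Longrightarrow> i < n \<Longrightarrow> j < n \<Longrightarrow> M $$ (i, j) \<in> carrier R"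
  by (simp add: mat_alg_carrier)

lemma finsum_delta:
  assumes "i < n" "f i \<in> carrier R"
  shows "(\<Oplus>k\<in>{..<n::nat}. if k = i then f k else \<zero>) = f i"
    "(\<Oplus>k\<in>{..<n::nat}. if i = k then f k else \<zero>) = f i"
proof -
  \<comment> \<open>Only \<open>f i\<close> is known to lie in the carrier; making the summand
    constant gives closure at every index.\<close>
  have "(\<Oplus>k\<in>{..<n}. if i = k then f k else \<zero>) = (\<Oplus>k\<in>{..<n}. if i = k then f i else \<zero>)"
    using assms by (intro finsum_cong') auto
  also have "\<dots> = f i"
    using assms finsum_singleton[of i "{..<n}" "\<lambda>_. f i"] by simp
  finally show "(\<Oplus>k\<in>{..<n}. if i = k then f k else \<zero>) = f i" .
  then show "(\<Oplus>k\<in>{..<n}. if k = i then f k else \<zero>) = f i"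
    by (simp add: eq_commute)
qed

lemma scalar_mat_closed [simp]:
  "a \<in> carrier R \<Longrightarrow> scalar_mat n R a \<in> carrier (mat_alg n R)"
  by (auto simp: mat_alg_carrier scalar_mat_def)

lemma scalar_mat_index:
  "i < n \<Longrightarrow> j < n \<Longrightarrow> scalar_mat n R a $$ (i, j) = (if i = j then a else \<zero>)"
  by (simp add: scalar_mat_def)

lemma scalar_mat_mult_index [simp]:
  assumes "a \<in> carrier R" "M \<in> carrier (mat_alg n R)" "i < n" "j < n"
  shows "(scalar_mat n R a \<otimes>\<^bsub>mat_alg n R\<^esub> M) $$ (i, j) = a \<otimes> M $$ (i, j)"
    "(M \<otimes>\<^bsub>mat_alg n R\<^esub> scalar_mat n R a) $$ (i, j) = M $$ (i, j) \<otimes> a"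
proof -
  have "(\<Oplus>k\<in>{..<n}. scalar_mat n R a $$ (i, k) \<otimes> M $$ (k, j)) =
      (\<Oplus>k\<in>{..<n}. if i = k then a \<otimes> M $$ (k, j) else \<zero>)"
    using assms by (intro finsum_cong') (auto simp: scalar_mat_index)
  then show "(scalar_mat n R a \<otimes>\<^bsub>mat_alg n R\<^esub> M) $$ (i, j) = a \<otimes> M $$ (i, j)"
    using assms by (simp add: finsum_delta(2)[of i n "\<lambda>k. a \<otimes> M $$ (k, j)"])
  have "(\<Oplus>k\<in>{..<n}. M $$ (i, k) \<otimes> scalar_mat n R a $$ (k, j)) =
      (\<Oplus>k\<in>{..<n}. if k = j then M $$ (i, k) \<otimes> a else \<zero>)"
    using assms by (intro finsum_cong') (auto simp: scalar_mat_index)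
  then show "(M \<otimes>\<^bsub>mat_alg n R\<^esub> scalar_mat n R a) $$ (i, j) = M $$ (i, j) \<otimes> a"
    using assms by (simp add: finsum_delta(1)[of j n "\<lambda>k. M $$ (i, k) \<otimes> a"])
qed

lemma mat_alg_mult_assoc:
  assumes "A \<in> carrier (mat_alg n R)" "B \<in> carrier (mat_alg n R)" "C \<in> carrier (mat_alg n R)"
  shows "A \<otimes>\<^bsub>mat_alg n R\<^esub> B \<otimes>\<^bsub>mat_alg n R\<^esub> C = A \<otimes>\<^bsub>mat_alg n R\<^esub> (B \<otimes>\<^bsub>mat_alg n R\<^esub> C)"
proof (rule mat_alg_eqI)
  fix i j assume ij: "i < n" "j < n"
  have "(A \<otimes>\<^bsub>mat_alg n R\<^esub> B \<otimes>\<^bsub>mat_alg n R\<^esub> C) $$ (i, j) =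
      (\<Oplus>k\<in>{..<n}. \<Oplus>l\<in>{..<n}. A $$ (i, l) \<otimes> B $$ (l, k) \<otimes> C $$ (k, j))"
    using assms ij by (auto intro!: finsum_cong' finsum_ldistr finsum_closed)
  also have "\<dots> = (\<Oplus>l\<in>{..<n}. \<Oplus>k\<in>{..<n}. A $$ (i, l) \<otimes> (B $$ (l, k) \<otimes> C $$ (k, j)))"
    using assms ij by (subst finsum_swap)
      (auto intro!: finsum_cong' finsum_closed m_assoc)
  also have "\<dots> = (A \<otimes>\<^bsub>mat_alg n R\<^esub> (B \<otimes>\<^bsub>mat_alg n R\<^esub> C)) $$ (i, j)"
    using assms ij by (auto intro!: finsum_cong' finsum_rdistr[symmetric] finsum_closed)
  finally show "(A \<otimes>\<^bsub>mat_alg n R\<^esub> B \<otimes>\<^bsub>mat_alg n R\<^esub> C) $$ (i, j) =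
    (A \<otimes>\<^bsub>mat_alg n R\<^esub> (B \<otimes>\<^bsub>mat_alg n R\<^esub> C)) $$ (i, j)" .
qed (use assms in simp_all)

lemma ring_mat_alg: "ring (mat_alg n R)"
proof (rule ringI)
  show "abelian_group (mat_alg n R)"
  proof (rule abelian_groupI)
    fix M assume M: "M \<in> carrier (mat_alg n R)"
    let ?N = "mat n n (\<lambda>ij. \<ominus> (M $$ ij))"
    have N: "?N \<in> carrier (mat_alg n R)"
      using M unfolding mat_alg_carrier by simp
    moreover have "?N \<oplus>\<^bsub>mat_alg n R\<^esub> M = \<zero>\<^bsub>mat_alg n R\<^esub>"
      using M N by (intro mat_alg_eqI[where n = n]) (simp_all add: l_neg)
    ultimately show "\<exists>N\<in>carrier (mat_alg n R). N \<oplus>\<^bsub>mat_alg n R\<^esub> M = \<zero>\<^bsub>mat_alg n R\<^esub>" ..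
  qed (auto intro!: mat_alg_eqI[where n = n] simp: a_ac)
  show "Group.monoid (mat_alg n R)"
  proof (rule monoidI)
    fix M assume M: "M \<in> carrier (mat_alg n R)"
    show "\<one>\<^bsub>mat_alg n R\<^esub> \<otimes>\<^bsub>mat_alg n R\<^esub> M = M" "M \<otimes>\<^bsub>mat_alg n R\<^esub> \<one>\<^bsub>mat_alg n R\<^esub> = M"
      \<comment> \<open>Read as the scalar matrix of one, the identity acts entrywise, and no sum
        has to be expanded.\<close>
      using M by (auto simp: scalar_mat_one[symmetric] simp del: mat_alg_index(1) intro!: mat_alg_eqI[where n = n])
  qed (auto simp: mat_alg_mult_assoc)
next
  fix A B C assume C: "A \<in> carrier (mat_alg n R)" "B \<in> carrier (mat_alg n R)" "C \<in> carrier (mat_alg n R)"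
  show "(A \<oplus>\<^bsub>mat_alg n R\<^esub> B) \<otimes>\<^bsub>mat_alg n R\<^esub> C =
      A \<otimes>\<^bsub>mat_alg n R\<^esub> C \<oplus>\<^bsub>mat_alg n R\<^esub> B \<otimes>\<^bsub>mat_alg n R\<^esub> C"
  proof (rule mat_alg_eqI)
    fix i j assume ij: "i < n" "j < n"
    have "(\<Oplus>k\<in>{..<n}. (A $$ (i, k) \<oplus> B $$ (i, k)) \<otimes> C $$ (k, j)) =
        (\<Oplus>k\<in>{..<n}. A $$ (i, k) \<otimes> C $$ (k, j) \<oplus> B $$ (i, k) \<otimes> C $$ (k, j))"
      using C ij by (intro finsum_cong') (auto simp: l_distr)
    also have "\<dots> = (\<Oplus>k\<in>{..<n}. A $$ (i, k) \<otimes> C $$ (k, j)) \<oplus> (\<Oplus>k\<in>{..<n}. B $$ (i, k) \<otimes> C $$ (k, j))"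
      using C ij by (intro finsum_addf) auto
    moreover have "((A \<oplus>\<^bsub>mat_alg n R\<^esub> B) \<otimes>\<^bsub>mat_alg n R\<^esub> C) $$ (i, j) =
        (\<Oplus>k\<in>{..<n}. (A $$ (i, k) \<oplus> B $$ (i, k)) \<otimes> C $$ (k, j))"
      using C ij by (simp, intro finsum_cong') auto
    ultimately show "((A \<oplus>\<^bsub>mat_alg n R\<^esub> B) \<otimes>\<^bsub>mat_alg n R\<^esub> C) $$ (i, j) =
        (A \<otimes>\<^bsub>mat_alg n R\<^esub> C \<oplus>\<^bsub>mat_alg n R\<^esub> B \<otimes>\<^bsub>mat_alg n R\<^esub> C) $$ (i, j)"
      using C ij by simp
  qed (use C in simp_all)
  show "C \<otimes>\<^bsub>mat_alg n R\<^esub> (A \<oplus>\<^bsub>mat_alg n R\<^esub> B) =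
      C \<otimes>\<^bsub>mat_alg n R\<^esub> A \<oplus>\<^bsub>mat_alg n R\<^esub> C \<otimes>\<^bsub>mat_alg n R\<^esub> B"
  proof (rule mat_alg_eqI)
    fix i j assume ij: "i < n" "j < n"
    have "(\<Oplus>k\<in>{..<n}. C $$ (i, k) \<otimes> (A $$ (k, j) \<oplus> B $$ (k, j))) =
        (\<Oplus>k\<in>{..<n}. C $$ (i, k) \<otimes> A $$ (k, j) \<oplus> C $$ (i, k) \<otimes> B $$ (k, j))"
      using C ij by (intro finsum_cong') (auto simp: r_distr)
    also have "\<dots> = (\<Oplus>k\<in>{..<n}. C $$ (i, k) \<otimes> A $$ (k, j)) \<oplus> (\<Oplus>k\<in>{..<n}. C $$ (i, k) \<otimes> B $$ (k, j))"
      using C ij by (intro finsum_addf) auto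
    moreover have "(C \<otimes>\<^bsub>mat_alg n R\<^esub> (A \<oplus>\<^bsub>mat_alg n R\<^esub> B)) $$ (i, j) =
        (\<Oplus>k\<in>{..<n}. C $$ (i, k) \<otimes> (A $$ (k, j) \<oplus> B $$ (k, j)))"
      using C ij by (simp, intro finsum_cong') auto
    ultimately show "(C \<otimes>\<^bsub>mat_alg n R\<^esub> (A \<oplus>\<^bsub>mat_alg n R\<^esub> B)) $$ (i, j) =
        (C \<otimes>\<^bsub>mat_alg n R\<^esub> A \<oplus>\<^bsub>mat_alg n R\<^esub> C \<otimes>\<^bsub>mat_alg n R\<^esub> B) $$ (i, j)"
      using C ij by simp
  qed (use C in simp_all)
qed

text \<open>The additive inverse in a ring record is determined only by its defining equation, so
  its entries are read off from \<open>M.l_neg\<close>.\<close>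

lemma mat_alg_a_inv_index [simp]:
  assumes "M \<in> carrier (mat_alg n R)" "i < n" "j < n"
  shows "(\<ominus>\<^bsub>mat_alg n R\<^esub> M) $$ (i, j) = \<ominus> (M $$ (i, j))"
proof -
  interpret M: ring "mat_alg n R" by (rule ring_mat_alg)
  have "(\<ominus>\<^bsub>mat_alg n R\<^esub> M \<oplus>\<^bsub>mat_alg n R\<^esub> M) $$ (i, j) = \<zero>"
    using assms by (simp only: M.l_neg mat_alg_index)
  then show ?thesis
    using assms mat_alg_entry_closed[OF M.a_inv_closed[OF assms(1)]]
    by (intro minus_equality[symmetric]) simp_all
qed

lemma scalar_mat_ring_hom: "scalar_mat n R \<in> Ring.ring_hom R (mat_alg n R)"
proof (rule ring_hom_memI)
  fix x y assume xy: "x \<in> carrier R" "y \<in> carrier R"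
  show "scalar_mat n R (x \<otimes> y) = scalar_mat n R x \<otimes>\<^bsub>mat_alg n R\<^esub> scalar_mat n R y"
    using xy by (intro mat_alg_eqI[where n = n]) (auto simp: scalar_mat_index simp del: mat_alg_index(1))
  show "scalar_mat n R (x \<oplus> y) = scalar_mat n R x \<oplus>\<^bsub>mat_alg n R\<^esub> scalar_mat n R y"
    using xy by (intro mat_alg_eqI[where n = n]) (auto simp: scalar_mat_index)
qed (simp_all add: scalar_mat_one)

text \<open>Over a noncommutative ring a scalar matrix need not be central, so commutation is
  required entry by entry. This serves both central scalars and the noncentral generators against
  quaternion units.\<close>

lemma scalar_mat_commute:
  assumes "a \<in> carrier R" "M \<in> carrier (mat_alg n R)"
    and "\<And>i j. i < n \<Longrightarrow> j < n \<Longrightarrow> a \<otimes> M $$ (i, j) = M $$ (i, j) \<otimes> a"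
  shows "scalar_mat n R a \<otimes>\<^bsub>mat_alg n R\<^esub> M = M \<otimes>\<^bsub>mat_alg n R\<^esub> scalar_mat n R a"
  using assms by (intro mat_alg_eqI[where n = n]) (auto simp del: mat_alg_index(1))

text \<open>Left multiplication by the quaternion units, in the basis \<open>1, i, j, k\<close>.\<close>

definition quat :: "gen \<Rightarrow> 'a mat" where
  "quat g =
     (case g of
        GX \<Rightarrow> mat_of_rows_list 4
          [[\<zero>, \<ominus> \<one>, \<zero>, \<zero>], [\<one>, \<zero>, \<zero>, \<zero>], [\<zero>, \<zero>, \<zero>, \<ominus> \<one>], [\<zero>, \<zero>, \<one>, \<zero>]]
      | GY \<Rightarrow> mat_of_rows_list 4
          [[\<zero>, \<zero>, \<ominus> \<one>, \<zero>], [\<zero>, \<zero>, \<zero>, \<one>], [\<one>, \<zero>, \<zero>, \<zero>], [\<zero>, \<ominus> \<one>, \<zero>, \<zero>]]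
      | GZ \<Rightarrow> mat_of_rows_list 4
          [[\<zero>, \<zero>, \<zero>, \<ominus> \<one>], [\<zero>, \<zero>, \<ominus> \<one>, \<zero>], [\<zero>, \<one>, \<zero>, \<zero>], [\<one>, \<zero>, \<zero>, \<zero>]])"

lemma quat_entry:
  assumes "i < 4" "j < 4"
  shows
    "quat GX $$ (i, j) =
      [[\<zero>, \<ominus> \<one>, \<zero>, \<zero>], [\<one>, \<zero>, \<zero>, \<zero>], [\<zero>, \<zero>, \<zero>, \<ominus> \<one>], [\<zero>, \<zero>, \<one>, \<zero>]] ! i ! j"
    "quat GY $$ (i, j) =
      [[\<zero>, \<zero>, \<ominus> \<one>, \<zero>], [\<zero>, \<zero>, \<zero>, \<one>], [\<one>, \<zero>, \<zero>, \<zero>], [\<zero>, \<ominus> \<one>, \<zero>, \<zero>]] ! i ! j"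
    "quat GZ $$ (i, j) =
      [[\<zero>, \<zero>, \<zero>, \<ominus> \<one>], [\<zero>, \<zero>, \<ominus> \<one>, \<zero>], [\<zero>, \<one>, \<zero>, \<zero>], [\<one>, \<zero>, \<zero>, \<zero>]] ! i ! j"
  using assms by (simp_all add: quat_def mat_of_rows_list_def)

text \<open>Such entries commute with every ring element, so a quaternion unit commutes with all
  scalar matrices, even noncentral ones.\<close>

lemma quat_index:
  assumes "i < 4" "j < 4"
  shows "quat g $$ (i, j) \<in> {\<zero>, \<one>, \<ominus> \<one>}"
  using assms
  by (cases g; elim less_4_cases) (simp_all add: quat_def mat_of_rows_list_def numeral_2_eq_2 numeral_3_eq_3)

lemma quat_closed [simp]: "quat g \<in> carrier (mat_alg 4 R)"
  unfolding mat_alg_carrier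
proof (intro conjI allI impI)
  show "quat g $$ (i, j) \<in> carrier R" if "i < 4" "j < 4" for i j
    using quat_index[OF that, of g] by auto
qed (rule carrier_matI; cases g; simp add: quat_def mat_of_rows_list_def)

lemma quat_entry_closed [simp]: "i < 4 \<Longrightarrow> j < 4 \<Longrightarrow> quat g $$ (i, j) \<in> carrier R"
  by (rule mat_alg_entry_closed[OF quat_closed])

lemma finsum_lessThan_4:
  assumes "\<And>i. i < 4 \<Longrightarrow> f i \<in> carrier R"
  shows "(\<Oplus>k\<in>{..<4::nat}. f k) = f 0 \<oplus> (f 1 \<oplus> (f 2 \<oplus> f 3))"
proof -
  have "{..<4::nat} = {0, 1, 2, 3}" by auto
  then show ?thesis using assms by simp
qed

text \<open>Hamilton's multiplication table for i, j, k, checked at the sixteen entries of each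
  product.\<close>

lemma quat_mult:
  "quat GX \<otimes>\<^bsub>mat_alg 4 R\<^esub> quat GX = \<ominus>\<^bsub>mat_alg 4 R\<^esub> \<one>\<^bsub>mat_alg 4 R\<^esub>"
  "quat GY \<otimes>\<^bsub>mat_alg 4 R\<^esub> quat GY = \<ominus>\<^bsub>mat_alg 4 R\<^esub> \<one>\<^bsub>mat_alg 4 R\<^esub>"
  "quat GZ \<otimes>\<^bsub>mat_alg 4 R\<^esub> quat GZ = \<ominus>\<^bsub>mat_alg 4 R\<^esub> \<one>\<^bsub>mat_alg 4 R\<^esub>"
  "quat GX \<otimes>\<^bsub>mat_alg 4 R\<^esub> quat GY = quat GZ"
  "quat GY \<otimes>\<^bsub>mat_alg 4 R\<^esub> quat GZ = quat GX"
  "quat GZ \<otimes>\<^bsub>mat_alg 4 R\<^esub> quat GX = quat GY"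
  "quat GY \<otimes>\<^bsub>mat_alg 4 R\<^esub> quat GX = \<ominus>\<^bsub>mat_alg 4 R\<^esub> quat GZ"
  "quat GZ \<otimes>\<^bsub>mat_alg 4 R\<^esub> quat GY = \<ominus>\<^bsub>mat_alg 4 R\<^esub> quat GX"
  "quat GX \<otimes>\<^bsub>mat_alg 4 R\<^esub> quat GZ = \<ominus>\<^bsub>mat_alg 4 R\<^esub> quat GY"
proof -
  interpret M: ring "mat_alg 4 R" by (rule ring_mat_alg)
  have fs: "(\<Oplus>k\<in>{..<4}. quat g $$ (i, k) \<otimes> quat h $$ (k, j)) =
      quat g $$ (i, 0) \<otimes> quat h $$ (0, j) \<oplus> (quat g $$ (i, 1) \<otimes> quat h $$ (1, j) \<oplus>
      (quat g $$ (i, 2) \<otimes> quat h $$ (2, j) \<oplus> quat g $$ (i, 3) \<otimes> quat h $$ (3, j)))"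
    if "i < 4" "j < 4" for g h i j
    using that by (intro finsum_lessThan_4) simp
  note eqI = mat_alg_eqI[OF M.m_closed[OF quat_closed quat_closed]]
  note s = fs quat_entry l_minus r_minus
  show
    "quat GX \<otimes>\<^bsub>mat_alg 4 R\<^esub> quat GX = \<ominus>\<^bsub>mat_alg 4 R\<^esub> \<one>\<^bsub>mat_alg 4 R\<^esub>"
    "quat GY \<otimes>\<^bsub>mat_alg 4 R\<^esub> quat GY = \<ominus>\<^bsub>mat_alg 4 R\<^esub> \<one>\<^bsub>mat_alg 4 R\<^esub>"
    "quat GZ \<otimes>\<^bsub>mat_alg 4 R\<^esub> quat GZ = \<ominus>\<^bsub>mat_alg 4 R\<^esub> \<one>\<^bsub>mat_alg 4 R\<^esub>"
    "quat GX \<otimes>\<^bsub>mat_alg 4 R\<^esub> quat GY = quat GZ"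
    "quat GY \<otimes>\<^bsub>mat_alg 4 R\<^esub> quat GZ = quat GX"
    "quat GZ \<otimes>\<^bsub>mat_alg 4 R\<^esub> quat GX = quat GY"
    "quat GY \<otimes>\<^bsub>mat_alg 4 R\<^esub> quat GX = \<ominus>\<^bsub>mat_alg 4 R\<^esub> quat GZ"
    "quat GZ \<otimes>\<^bsub>mat_alg 4 R\<^esub> quat GY = \<ominus>\<^bsub>mat_alg 4 R\<^esub> quat GX"
    "quat GX \<otimes>\<^bsub>mat_alg 4 R\<^esub> quat GZ = \<ominus>\<^bsub>mat_alg 4 R\<^esub> quat GY"
    by (rule eqI, simp; elim less_4_cases; simp add: s)+
qed

end

section \<open>Two commuting triples\<close>

text \<open>The brackets of su(2) and the quaternion table are invariant under this cyclic rotation,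
  so one statement about \<open>g\<close> replaces three.\<close>

fun next_gen :: "gen \<Rightarrow> gen" where
  "next_gen GX = GY" | "next_gen GY = GZ" | "next_gen GZ = GX"

lemma next_gen_3: "next_gen (next_gen (next_gen g)) = g"
  by (cases g) simp_all

text \<open>Such a map makes \<open>S\<close> an algebra over the field. The computations behind
  \<Theta>(r) take place in this abstract setting, away from matrix entries.\<close>

locale central_hom = ring S for S :: "('s, 'm) ring_scheme" (structure) +
  fixes Z :: "'k::field \<Rightarrow> 's"
  assumes Z_closed [simp, intro]: "Z c \<in> carrier S"
    and Z_add: "Z (c + d) = Z c \<oplus> Z d"
    and Z_mult: "Z (c * d) = Z c \<otimes> Z d"
    and Z_1 [simp]: "Z 1 = \<one>"
    and Z_central: "a \<in> carrier S \<Longrightarrow> a \<otimes> Z c = Z c \<otimes> a"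
begin

lemma Z_0 [simp]: "Z 0 = \<zero>"
  using Z_add[of 0 0] Z_closed[of 0] by (metis add.r_cancel_one' add_0)

lemma Z_minus: "Z (- c) = \<ominus> Z c"
  using Z_add[of "- c" c] by (intro minus_equality[symmetric]) simp_all

lemma Z_lcomm: "a \<in> carrier S \<Longrightarrow> b \<in> carrier S \<Longrightarrow> a \<otimes> (Z c \<otimes> b) = Z c \<otimes> (a \<otimes> b)"
  by (simp add: m_assoc[symmetric] Z_central)

lemma Z_Z: "a \<in> carrier S \<Longrightarrow> Z c \<otimes> (Z d \<otimes> a) = Z (c * d) \<otimes> a"
  by (simp add: m_assoc Z_mult)

lemma lin_add:
  assumes "a \<in> carrier S"
  shows "(Z c \<oplus> Z d \<otimes> a) \<oplus> (Z c' \<oplus> Z d' \<otimes> a) = Z (c + c') \<oplus> Z (d + d') \<otimes> a"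
  using assms by (simp add: Z_add l_distr a_ac)

lemma lin_scale:
  assumes "a \<in> carrier S"
  shows "Z e \<otimes> (Z c \<oplus> Z d \<otimes> a) = Z (e * c) \<oplus> Z (e * d) \<otimes> a"
  using assms by (simp add: Z_mult r_distr m_assoc)

text \<open>Multiplication of linear expressions modulo a quadratic relation for \<open>a\<close>.
  It is used for \<open>N\<close> and then for \<open>J\<close>, and reduces identities between
  products to a comparison of two coefficients.\<close>

lemma lin_mult:
  assumes a: "a \<in> carrier S" and aa: "a \<otimes> a = Z m \<oplus> Z n \<otimes> a"
  shows "(Z c \<oplus> Z d \<otimes> a) \<otimes> (Z c' \<oplus> Z d' \<otimes> a) =
    Z (c * c' + d * d' * m) \<oplus> Z (c * d' + d * c' + d * d' * n) \<otimes> a"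
proof -
  have dd: "(Z d \<otimes> a) \<otimes> (Z d' \<otimes> a) = Z (d * d' * m) \<oplus> Z (d * d' * n) \<otimes> a"
  proof -
    have "(Z d \<otimes> a) \<otimes> (Z d' \<otimes> a) = Z (d * d') \<otimes> (a \<otimes> a)"
      using a by (simp add: m_assoc Z_lcomm[OF a] Z_mult)
    then show ?thesis by (simp add: aa lin_scale a)
  qed
  have "(Z c \<oplus> Z d \<otimes> a) \<otimes> (Z c' \<oplus> Z d' \<otimes> a) =
      Z (c * c') \<oplus> Z (c * d') \<otimes> a \<oplus> (Z (d * c') \<otimes> a \<oplus> (Z d \<otimes> a) \<otimes> (Z d' \<otimes> a))"
    using a by (simp add: l_distr r_distr Z_mult m_assoc Z_central[OF a] a_ac)
  also have "\<dots> = Z (c * c' + d * d' * m) \<oplus> Z (c * d' + d * c' + d * d' * n) \<otimes> a"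
    unfolding dd using a by (simp add: Z_add l_distr a_ac)
  finally show ?thesis .
qed

end

text \<open>\<open>u\<close>, \<open>v\<close>, \<open>2u\<close> stand for \<open>i\<hbar>\<close>, \<open>\<hbar>\<close>, \<open>h\<close>, and \<open>d g\<close> for \<open>u\<close> times a quaternion unit.\<close>

locale quat_su2 = central_hom S Z for S :: "('s, 'm) ring_scheme" (structure) and Z :: "'k::field \<Rightarrow> 's" +
  fixes x d :: "gen \<Rightarrow> 's" and u v r :: 'k
  assumes x_closed [simp, intro]: "x g \<in> carrier S"
    and d_closed [simp, intro]: "d g \<in> carrier S"
    and dx: "d g \<otimes> x g' = x g' \<otimes> d g"
    and xx: "x g \<otimes> x (next_gen g) =
      x (next_gen g) \<otimes> x g \<oplus> Z (2 * u) \<otimes> x (next_gen (next_gen g))"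
    and d_sq: "d g \<otimes> d g = Z (v * v)"
    and d_next: "d g \<otimes> d (next_gen g) = Z u \<otimes> d (next_gen (next_gen g))"
    and d_prev: "d (next_gen g) \<otimes> d g = \<ominus> (Z u \<otimes> d (next_gen (next_gen g)))"
    and u_sq: "u * u = - (v * v)"
    and x_cas: "x GX \<otimes> x GX \<oplus> x GY \<otimes> x GY \<oplus> x GZ \<otimes> x GZ = Z (r * r - v * v)"
begin

lemmas x_Z = Z_central[OF x_closed] Z_lcomm[OF x_closed]
lemmas d_Z = Z_central[OF d_closed] Z_lcomm[OF d_closed]

text \<open>The two products are opposite, so passing to the commutator doubles \<open>u\<close>:
  the triple \<open>d\<close> has the same brackets as \<open>x\<close>.\<close>

lemma dd: "d g \<otimes> d (next_gen g) =
    d (next_gen g) \<otimes> d g \<oplus> Z (2 * u) \<otimes> d (next_gen (next_gen g))"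
proof -
  have "Z (2 * u) = Z u \<oplus> Z u" by (simp flip: Z_add)
  then show ?thesis
    by (simp add: d_next d_prev l_distr r_neg1)
qed

definition y :: "gen \<Rightarrow> 's" where
  "y g = x g \<oplus> d g"

lemma y_closed [simp, intro]: "y g \<in> carrier S"
  by (simp add: y_def)

lemmas y_Z = Z_central[OF y_closed] Z_lcomm[OF y_closed]

text \<open>The invariant pairing of two commuting copies of su(2), as in spin-orbit coupling: half
  of the cross term in the Casimir element of \<open>x + d\<close>.\<close>

definition N :: 's where
  "N = x GX \<otimes> d GX \<oplus> x GY \<otimes> d GY \<oplus> x GZ \<otimes> d GZ"

lemma N_closed [simp, intro]: "N \<in> carrier S"
  by (simp add: N_def)

lemma N_rotate: "N = x g \<otimes> d g \<oplus> x (next_gen g) \<otimes> d (next_gen g) \<oplus>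
    x (next_gen (next_gen g)) \<otimes> d (next_gen (next_gen g))"
  by (cases g) (simp_all add: N_def a_ac)

lemma yy: "y g \<otimes> y (next_gen g) =
    y (next_gen g) \<otimes> y g \<oplus> Z (2 * u) \<otimes> y (next_gen (next_gen g))"
  by (simp add: y_def l_distr r_distr xx dd dx a_ac)

text \<open>In the commutator of \<open>N\<close> with \<open>y a\<close>, brackets of
  \<open>x\<close> cancel against brackets of \<open>d\<close>: from [x c, x a] d c one gets 2u (x
  b)(d c), from (x b) [d b, d a] its negative, and likewise with b and c exchanged up to
  sign.\<close>

lemma N_y_commute: "N \<otimes> y g = y g \<otimes> N"
proof -
  define a b c where "a = g" and "b = next_gen g" and "c = next_gen (next_gen g)"
  have ca: "next_gen c = a" by (simp add: a_def c_def next_gen_3)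
  \<comment> \<open>The rules are oriented to order products as b before a before c. No bracket of b
    with c occurs, because one of the two factors always has index a.\<close>
  have x_ab: "x a \<otimes> x b = x b \<otimes> x a \<oplus> Z (2 * u) \<otimes> x c"
    and d_ab: "d a \<otimes> d b = d b \<otimes> d a \<oplus> Z (2 * u) \<otimes> d c"
    using xx[of g] dd[of g] by (simp_all add: a_def b_def c_def)
  have x_ca: "x c \<otimes> x a = x a \<otimes> x c \<oplus> Z (2 * u) \<otimes> x b"
    and d_ca: "d c \<otimes> d a = d a \<otimes> d c \<oplus> Z (2 * u) \<otimes> d b"
    using xx[of c] dd[of c] by (simp_all add: ca, simp_all add: a_def b_def)
  have N: "N = x a \<otimes> d a \<oplus> x b \<otimes> d b \<oplus> x c \<otimes> d c"
    unfolding a_def b_def c_def by (rule N_rotate)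
  have dxl: "d i \<otimes> (x j \<otimes> w) = x j \<otimes> (d i \<otimes> w)" if "w \<in> carrier S" for i j w
    using that by (simp add: m_assoc[symmetric] dx)
  have x_abl: "x a \<otimes> (x b \<otimes> w) = x b \<otimes> (x a \<otimes> w) \<oplus> Z (2 * u) \<otimes> (x c \<otimes> w)"
    and x_cal: "x c \<otimes> (x a \<otimes> w) = x a \<otimes> (x c \<otimes> w) \<oplus> Z (2 * u) \<otimes> (x b \<otimes> w)"
    if "w \<in> carrier S" for w
    using that by (simp_all add: m_assoc[symmetric] x_ab x_ca l_distr)
  show ?thesis
    unfolding N y_def a_def[symmetric]
    by (simp add: l_distr r_distr m_assoc dxl dx x_abl x_cal d_ab d_ca x_Z(2) d_Z(2) a_ac)
qed

text \<open>The triple \<open>x\<close> contributes r^2 - v^2, the three squares of \<open>d\<close>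
  contribute 3 v^2, and the cross terms give 2 N.\<close>

lemma cas_y: "y GX \<otimes> y GX \<oplus> y GY \<otimes> y GY \<oplus> y GZ \<otimes> y GZ = Z (r * r + 2 * (v * v)) \<oplus> Z 2 \<otimes> N"
proof -
  have y_sq: "y g \<otimes> y g = x g \<otimes> x g \<oplus> (x g \<otimes> d g \<oplus> x g \<otimes> d g) \<oplus> Z (v * v)" for g
    by (simp add: y_def l_distr r_distr dx d_sq a_ac)
  have Z3: "Z (3 * (v * v)) = Z (v * v) \<oplus> (Z (v * v) \<oplus> Z (v * v))"
    by (simp flip: Z_add)
  have "Z 2 \<otimes> N = N \<oplus> N"
    using Z_add[of 1 1] by (simp add: l_distr)
  moreover have "y GX \<otimes> y GX \<oplus> y GY \<otimes> y GY \<oplus> y GZ \<otimes> y GZ =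
      (x GX \<otimes> x GX \<oplus> x GY \<otimes> x GY \<oplus> x GZ \<otimes> x GZ) \<oplus> (N \<oplus> N) \<oplus> (Z (v * v) \<oplus> Z (v * v) \<oplus> Z (v * v))"
    by (simp add: y_sq N_def a_ac)
  ultimately have "y GX \<otimes> y GX \<oplus> y GY \<otimes> y GY \<oplus> y GZ \<otimes> y GZ =
      Z (r * r - v * v) \<oplus> Z (3 * (v * v)) \<oplus> Z 2 \<otimes> N"
    by (simp add: x_cas Z3 a_ac)
  then show ?thesis by (simp add: add.commute flip: Z_add)
qed

text \<open>The diagonal terms give v^2 times the Casimir element of \<open>x\<close>. In an
  off-diagonal pair the products of \<open>d\<close> are opposite, so only the commutator of
  \<open>x\<close> survives; it yields 2 u^2 = -2 v^2 times the third summand of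
  \<open>N\<close>.\<close>

lemma N_sq: "N \<otimes> N = Z (v * v * (r * r - v * v)) \<oplus> Z (- 2 * (v * v)) \<otimes> N"
proof -
  define T where "T i j = x i \<otimes> x j \<otimes> (d i \<otimes> d j)" for i j
  have T_closed [simp]: "T i j \<in> carrier S" for i j by (simp add: T_def)
  have T: "(x i \<otimes> d i) \<otimes> (x j \<otimes> d j) = T i j" for i j
  proof -
    have "(x i \<otimes> d i) \<otimes> (x j \<otimes> d j) = x i \<otimes> ((d i \<otimes> x j) \<otimes> d j)"
      by (simp add: m_assoc)
    then show ?thesis by (simp add: dx T_def m_assoc)
  qed
  have diag: "T i i = Z (v * v) \<otimes> (x i \<otimes> x i)" for i
    by (simp add: T_def d_sq Z_central[of "x i \<otimes> x i"])
  have off: "T g (next_gen g) \<oplus> T (next_gen g) g =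
      Z (- 2 * (v * v)) \<otimes> (x (next_gen (next_gen g)) \<otimes> d (next_gen (next_gen g)))" for g
  proof -
    let ?a = "x (next_gen g) \<otimes> x g" and ?xc = "x (next_gen (next_gen g))"
    let ?w = "Z u \<otimes> d (next_gen (next_gen g))"
    have "T g (next_gen g) \<oplus> T (next_gen g) g = (?a \<oplus> Z (2 * u) \<otimes> ?xc) \<otimes> ?w \<oplus> ?a \<otimes> \<ominus> ?w"
      by (simp only: T_def xx d_next d_prev)
    also have "\<dots> = Z (2 * u) \<otimes> ?xc \<otimes> ?w"
      by (simp add: l_distr r_minus a_ac r_neg2 r_neg1 r_neg)
    also have "\<dots> = Z (2 * u * u) \<otimes> (?xc \<otimes> d (next_gen (next_gen g)))"
      by (simp add: m_assoc x_Z Z_mult)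
    also have "2 * u * u = - 2 * (v * v)"
      using u_sq by (simp add: mult.assoc)
    finally show ?thesis .
  qed
  have "N \<otimes> N = (T GX GX \<oplus> T GY GY \<oplus> T GZ GZ) \<oplus>
      ((T GY GZ \<oplus> T GZ GY) \<oplus> (T GZ GX \<oplus> T GX GZ) \<oplus> (T GX GY \<oplus> T GY GX))"
    by (simp add: N_def l_distr r_distr T a_ac)
  also have "\<dots> = Z (v * v) \<otimes> (x GX \<otimes> x GX \<oplus> x GY \<otimes> x GY \<oplus> x GZ \<otimes> x GZ) \<oplus> Z (- 2 * (v * v)) \<otimes> N"
    using off[of GY] off[of GZ] off[of GX] by (simp add: diag N_def r_distr)
  finally show ?thesis
    by (simp add: x_cas Z_mult)
qed

end

text \<open>The endomorphisms \<open>sp\<close> and \<open>sm\<close> describe how a coefficient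
  acts where \<Theta>(r) has the eigenvalue r + v or r - v, that is, where \<open>J\<close> is 1 or
  -1.\<close>

locale quat_su2_shift = quat_su2 S Z x d u v r
  for S :: "('s, 'm) ring_scheme" (structure) and Z :: "'k::field \<Rightarrow> 's" and x d u v r +
  fixes sp sm :: "'k \<Rightarrow> 'k"
  assumes sp_add: "sp (a + b) = sp a + sp b" and sp_mult: "sp (a * b) = sp a * sp b"
    and sp_1 [simp]: "sp 1 = 1"
    and sm_add: "sm (a + b) = sm a + sm b" and sm_mult: "sm (a * b) = sm a * sm b"
    and sm_1 [simp]: "sm 1 = 1"
    and sp_r: "sp r = r + v" and sm_r: "sm r = r - v"
    and nonzero: "(2::'k) \<noteq> 0" "v \<noteq> 0" "r \<noteq> 0"
begin

lemma powers_of_2_nonzero: "(4::'k) \<noteq> 0" "(16::'k) \<noteq> 0"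
proof -
  show four: "(4::'k) \<noteq> 0"
    using nonzero(1) mult_eq_0_iff[of "2::'k" 2] by simp
  show "(16::'k) \<noteq> 0"
    using four mult_eq_0_iff[of "4::'k" 4] by simp
qed

text \<open>An involution: \<open>\<Theta>(r) = r + v J\<close>, so that \<open>\<Theta>(r)\<close> has the eigenvalues \<open>r \<plusminus> v\<close>.\<close>

definition J :: 's where
  "J = Z (v / r) \<oplus> Z (1 / (v * r)) \<otimes> N"

lemma J_closed [simp, intro]: "J \<in> carrier S"
  by (simp add: J_def)

text \<open>Here J = (N + v^2) / (v r), and completing the square in \<open>N_sq\<close> gives (N +
  v^2)^2 = v^2 r^2. The right-hand side keeps a zero coefficient of \<open>J\<close> to fit the
  quadratic relation in \<open>lin_mult\<close>.\<close>

lemma J_sq: "J \<otimes> J = Z 1 \<oplus> Z 0 \<otimes> J"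
proof -
  have "J \<otimes> J = Z 1 \<oplus> Z 0 \<otimes> N"
    unfolding J_def
    by (subst lin_mult[OF N_closed N_sq], rule arg_cong2[of _ _ _ _ "\<lambda>a b. Z a \<oplus> Z b \<otimes> N"])
       (use nonzero powers_of_2_nonzero in \<open>simp_all add: field_simps\<close>)
  then show ?thesis by simp
qed

text \<open>This is \<open>sp f\<close> times (1 + J)/2 plus \<open>sm f\<close> times (1 - J)/2,
  sorted by powers of \<open>J\<close> so that \<open>lin_add\<close> and \<open>lin_mult\<close>
  apply.\<close>

definition \<phi> :: "'k \<Rightarrow> 's" where
  "\<phi> f = Z ((sp f + sm f) / 2) \<oplus> Z ((sp f - sm f) / 2) \<otimes> J"

lemma \<phi>_closed [simp, intro]: "\<phi> f \<in> carrier S"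
  by (simp add: \<phi>_def)

lemma \<phi>_add: "\<phi> (f + g) = \<phi> f \<oplus> \<phi> g"
  unfolding \<phi>_def
  by (subst lin_add[OF J_closed], rule arg_cong2[of _ _ _ _ "\<lambda>a b. Z a \<oplus> Z b \<otimes> J"])
     (use nonzero powers_of_2_nonzero in \<open>simp_all add: sp_add sm_add field_simps\<close>)

text \<open>Since J^2 = 1, the elements (1 + J)/2 and (1 - J)/2 are orthogonal idempotents, and
  \<open>sp\<close> and \<open>sm\<close> are multiplicative on the respective components.\<close>

lemma \<phi>_mult: "\<phi> (f * g) = \<phi> f \<otimes> \<phi> g"
  unfolding \<phi>_def
  by (subst lin_mult[OF J_closed J_sq], rule arg_cong2[of _ _ _ _ "\<lambda>a b. Z a \<oplus> Z b \<otimes> J"])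
     (use nonzero powers_of_2_nonzero in \<open>simp_all add: sp_mult sm_mult field_simps\<close>)

text \<open>When the shifts agree, the coefficient of \<open>J\<close> vanishes. This covers the
  constants and t.\<close>

lemma \<phi>_fixed: "sp f = g \<Longrightarrow> sm f = g \<Longrightarrow> \<phi> f = Z g"
  using nonzero by (simp add: \<phi>_def flip: mult_2)

lemma \<phi>_1 [simp]: "\<phi> 1 = \<one>"
  using \<phi>_fixed[of 1 1] by simp

text \<open>Half the sum and half the difference of r + v and r - v give r + v J; expanding
  \<open>J\<close> produces the form in which \<Theta>(r) is prescribed.\<close>

lemma \<phi>_r: "\<phi> r = Z (1 / r) \<otimes> (Z (r * r + v * v) \<oplus> N)"
proof -
  have "\<phi> r = Z r \<oplus> Z v \<otimes> J"
    unfolding \<phi>_def sp_r sm_r using nonzero by (simp flip: mult_2)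
  also have "\<dots> = Z (r + v * v / r) \<oplus> Z (1 / r) \<otimes> N"
    using nonzero by (simp add: J_def lin_scale Z_add a_assoc)
  also have "\<dots> = Z (1 / r) \<otimes> (Z (r * r + v * v) \<oplus> N)"
    using nonzero lin_scale[OF N_closed, of "1 / r" "r * r + v * v" 1]
    by (simp add: add_divide_distrib)
  finally show ?thesis .
qed

text \<open>Compatibility with the Casimir relation: (r + v J)^2 = r^2 + v^2 + 2 r v J, where 2 r v
  J = 2 v^2 + 2 N, and \<open>cas_y\<close> identifies the rest.\<close>

lemma \<phi>_r_sq: "\<phi> (r * r) = Z (v * v) \<oplus> (y GX \<otimes> y GX \<oplus> y GY \<otimes> y GY \<oplus> y GZ \<otimes> y GZ)"
proof -
  have "\<phi> (r * r) = Z (r * r + v * v) \<oplus> Z (2 * r * v) \<otimes> J"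
    unfolding \<phi>_def sp_r sm_r sp_mult sm_mult
    by (rule arg_cong2[of _ _ _ _ "\<lambda>a b. Z a \<oplus> Z b \<otimes> J"])
       (use nonzero powers_of_2_nonzero in \<open>simp_all add: field_simps\<close>)
  also have "\<dots> = Z (r * r + v * v) \<oplus> (Z (2 * (v * v)) \<oplus> Z 2 \<otimes> N)"
    using nonzero by (simp add: J_def lin_scale)
  also have "\<dots> = Z (v * v) \<oplus> (Z (r * r + 2 * (v * v)) \<oplus> Z 2 \<otimes> N)"
    by (simp add: Z_add a_ac)
  finally show ?thesis by (simp add: cas_y)
qed

text \<open>Each \<open>\<phi> f\<close> is a linear expression in \<open>N\<close> with central
  coefficients, so \<open>N_y_commute\<close> suffices.\<close>

lemma \<phi>_y_commute: "\<phi> f \<otimes> y g = y g \<otimes> \<phi> f"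
proof -
  have "J \<otimes> y g = y g \<otimes> J"
    by (simp add: J_def l_distr r_distr m_assoc y_Z N_y_commute)
  then show ?thesis
    by (simp add: \<phi>_def l_distr r_distr m_assoc y_Z)
qed

end

section \<open>Shifts of rational functions\<close>

text \<open>The choice picks one representation as a fraction. For an injective homomorphism the
  value does not depend on it: cross-multiplication is preserved and denominators stay
  nonzero.\<close>

definition fract_lift :: "('a::idom \<Rightarrow> 'b::field) \<Rightarrow> 'a fract \<Rightarrow> 'b" where
  "fract_lift h f = (SOME y. \<exists>p q. q \<noteq> 0 \<and> f = Fraction_Field.Fract p q \<and> y = h p / h q)"

locale inj_hom_to_field =
  fixes h :: "'a::idom \<Rightarrow> 'b::field"
  assumes h_add: "h (p + q) = h p + h q" and h_mult: "h (p * q) = h p * h q"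
    and h_1 [simp]: "h 1 = 1" and h_eq_0: "h p = 0 \<Longrightarrow> p = 0"
begin

lemma fract_lift_Fract:
  assumes "q \<noteq> 0"
  shows "fract_lift h (Fraction_Field.Fract p q) = h p / h q"
  unfolding fract_lift_def
proof (rule some_equality)
  show "\<exists>p' q'. q' \<noteq> 0 \<and> Fraction_Field.Fract p q = Fraction_Field.Fract p' q' \<and> h p / h q = h p' / h q'"
    using assms by blast
next
  fix y assume "\<exists>p' q'. q' \<noteq> 0 \<and> Fraction_Field.Fract p q = Fraction_Field.Fract p' q' \<and> y = h p' / h q'"
  then obtain p' q' where q': "q' \<noteq> 0" "Fraction_Field.Fract p q = Fraction_Field.Fract p' q'"
    and y: "y = h p' / h q'" by blast
  then have "p * q' = p' * q" using assms by (simp add: eq_fract)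
  then have "h p * h q' = h p' * h q" by (metis h_mult)
  moreover have "h q \<noteq> 0" "h q' \<noteq> 0" using assms q' h_eq_0 by blast+
  ultimately show "y = h p / h q" by (simp add: y field_simps)
qed

lemma fract_lift_add: "fract_lift h (f + g) = fract_lift h f + fract_lift h g"
proof (cases f, cases g)
  fix a b c d assume f: "f = Fraction_Field.Fract a b" "b \<noteq> 0" and g: "g = Fraction_Field.Fract c d" "d \<noteq> 0"
  moreover from f g have "h b \<noteq> 0" "h d \<noteq> 0" using h_eq_0 by blast+
  ultimately show ?thesis
    by (simp add: fract_lift_Fract h_add h_mult field_simps)
qed

lemma fract_lift_mult: "fract_lift h (f * g) = fract_lift h f * fract_lift h g"
proof (cases f, cases g)
  fix a b c d assume "f = Fraction_Field.Fract a b" "b \<noteq> 0" and "g = Fraction_Field.Fract c d" "d \<noteq> 0"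
  then show ?thesis
    by (simp add: fract_lift_Fract h_mult)
qed

lemma fract_lift_1: "fract_lift h 1 = 1"
  by (simp add: One_fract_def fract_lift_Fract)

end

section \<open>Shifts of both variables: t inside the coefficients, r as the outer variable\<close>

definition shift_poly :: "complex \<Rightarrow> complex \<Rightarrow> complex poly poly \<Rightarrow> complex poly poly" where
  "shift_poly a b p = pcompose (map_poly (\<lambda>c. pcompose c [:a, 1:]) p) [:[:b:], 1:]"

definition shift :: "complex \<Rightarrow> complex \<Rightarrow> ratfun \<Rightarrow> ratfun" where
  "shift a b = fract_lift (\<lambda>p. Fraction_Field.Fract (shift_poly a b p) 1)"

lemma shift_poly_mult: "shift_poly a b (p * q) = shift_poly a b p * shift_poly a b q"
proof -
  have "map_poly (\<lambda>c. pcompose c [:a, 1:]) (p * q) =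
      map_poly (\<lambda>c. pcompose c [:a, 1:]) p * map_poly (\<lambda>c. pcompose c [:a, 1:]) q"
    by (rule poly_eqI) (simp add: coeff_map_poly coeff_mult pcompose_sum pcompose_mult)
  then show ?thesis by (simp add: shift_poly_def pcompose_mult)
qed

text \<open>Composition with a polynomial of positive degree is injective; this is applied to the
  outer variable and then to each coefficient. Hence no denominator is killed by a shift.\<close>

lemma shift_poly_eq_0:
  assumes "shift_poly a b p = 0"
  shows "p = 0"
proof -
  have "map_poly (\<lambda>c. pcompose c [:a, 1:]) p = 0"
    using assms unfolding shift_poly_def by (rule pcompose_eq_0) simp
  moreover have "coeff (map_poly (\<lambda>c. pcompose c [:a, 1:]) p) n = pcompose (coeff p n) [:a, 1:]" for n
    by (simp add: coeff_map_poly)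
  ultimately have "pcompose (coeff p n) [:a, 1:] = 0" for n
    by simp
  then have "coeff p n = 0" for n
    by (rule pcompose_eq_0) simp
  then show ?thesis by (intro poly_eqI) simp
qed

interpretation shift_hom: inj_hom_to_field "\<lambda>p. Fraction_Field.Fract (shift_poly a b p) 1"
proof
  have "map_poly (\<lambda>c. pcompose c [:a, 1:]) (p + q) =
      map_poly (\<lambda>c. pcompose c [:a, 1:]) p + map_poly (\<lambda>c. pcompose c [:a, 1:]) q" for p q
    by (rule poly_eqI) (simp add: coeff_map_poly pcompose_add)
  then show "Fraction_Field.Fract (shift_poly a b (p + q)) 1 =
      Fraction_Field.Fract (shift_poly a b p) 1 + Fraction_Field.Fract (shift_poly a b q) 1" for p q
    by (simp add: shift_poly_def pcompose_add)
  show "Fraction_Field.Fract (shift_poly a b 1) 1 = 1"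
    using map_poly_pCons[of "\<lambda>c. pcompose c [:a, 1:]" 1 0]
    by (simp add: shift_poly_def pcompose_1 One_fract_def one_pCons[symmetric] flip: pCons_one)
  show "p = 0" if "Fraction_Field.Fract (shift_poly a b p) 1 = 0" for p
    using that by (simp add: Zero_fract_def eq_fract shift_poly_eq_0)
qed (simp add: shift_poly_mult)

lemmas shift_add = shift_hom.fract_lift_add[folded shift_def]
lemmas shift_mult = shift_hom.fract_lift_mult[folded shift_def]
lemmas shift_1 [simp] = shift_hom.fract_lift_1[folded shift_def]

lemma shift_Fract_1: "shift a b (Fraction_Field.Fract p 1) = Fraction_Field.Fract (shift_poly a b p) 1"
  unfolding shift_def by (subst shift_hom.fract_lift_Fract) (simp_all add: shift_hom.h_1)

section \<open>Constants and variables in the field of rational functions\<close>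

lemma rf_cst_add: "rf_cst (a + b) = rf_cst a + rf_cst b"
  and rf_cst_mult: "rf_cst (a * b) = rf_cst a * rf_cst b"
  and rf_cst_1 [simp]: "rf_cst 1 = 1"
  by (simp_all add: rf_cst_def One_fract_def flip: pCons_one)

lemma rf_cst_minus: "rf_cst (- a) = - rf_cst a"
  by (simp add: rf_cst_def)

lemma rf_cst_eq_0 [simp]: "rf_cst a = 0 \<longleftrightarrow> a = 0"
  by (simp add: rf_cst_def Zero_fract_def eq_fract)

lemma rf_cst_2: "rf_cst 2 = 2"
  using rf_cst_add[of 1 1] by simp

lemma rf_r_nonzero: "rf_r \<noteq> 0"
  by (simp add: rf_r_def Zero_fract_def eq_fract)

lemma shift_cst: "shift a b (rf_cst c) = rf_cst c"
  by (simp add: rf_cst_def shift_Fract_1 shift_poly_def map_poly_pCons pcompose_pCons pcompose_1)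

lemma shift_t: "shift a b rf_t = rf_t + rf_cst a"
  by (simp add: rf_t_def rf_cst_def shift_Fract_1 shift_poly_def map_poly_pCons pcompose_pCons pcompose_1)

lemma shift_r: "shift a b rf_r = rf_r + rf_cst b"
  by (simp add: rf_r_def rf_cst_def shift_Fract_1 shift_poly_def map_poly_pCons pcompose_pCons pcompose_1)

text \<open>The double sum has exactly the shape of \<open>Theta_subst\<close>, so that a ring
  homomorphism can be applied to it term by term.\<close>

lemma Fract_eq_sum:
  "Fraction_Field.Fract p 1 = (\<Sum>j\<le>Polynomial.degree p. \<Sum>i\<le>Polynomial.degree (Polynomial.coeff p j).
    rf_cst (Polynomial.coeff (Polynomial.coeff p j) i) * rf_t ^ i * rf_r ^ j)"
proof -
  have add2: "Fraction_Field.Fract (q + q') 1 = Fraction_Field.Fract q 1 + Fraction_Field.Fract q' 1"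
    for q q' :: "complex poly poly"
    by simp
  have add: "Fraction_Field.Fract (\<Sum>x\<in>A. f x) 1 = (\<Sum>x\<in>A. Fraction_Field.Fract (f x) 1)"
    for f :: "nat \<Rightarrow> complex poly poly" and A
    by (induction A rule: infinite_finite_induct) (simp_all add: Zero_fract_def add2 del: add_fract)
  have pow: "Fraction_Field.Fract (q ^ i) 1 = Fraction_Field.Fract q 1 ^ i" for q :: "complex poly poly" and i
  proof (induction i)
    case (Suc i)
    show ?case unfolding power_Suc Suc[symmetric] by simp
  qed (simp add: One_fract_def)
  have "p = (\<Sum>j\<le>Polynomial.degree p. [:Polynomial.coeff p j:] * [:0, 1:] ^ j)"
    using poly_as_sum_of_monoms[of p] by (simp add: monom_altdef)
  also have "\<dots> = (\<Sum>j\<le>Polynomial.degree p. \<Sum>i\<le>Polynomial.degree (Polynomial.coeff p j).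
      [:[:Polynomial.coeff (Polynomial.coeff p j) i:]:] * [:[:0, 1:]:] ^ i * [:0, 1:] ^ j)"
  \<comment> \<open>Each coefficient is expanded in t, and the embedding of constants is carried
    through sums and powers.\<close>
  proof (rule sum.cong[OF refl])
    fix j
    define c where "c = Polynomial.coeff p j"
    have cadd2: "[:a + b:] = [:a:] + [:b:]" for a b :: "complex poly"
      by simp
    have cadd: "[:\<Sum>x\<in>A. f x:] = (\<Sum>x\<in>A. [:f x:])" for f :: "nat \<Rightarrow> complex poly" and A
      by (induction A rule: infinite_finite_induct) (simp_all add: cadd2 del: add_pCons)
    have "c = (\<Sum>i\<le>Polynomial.degree c. [:Polynomial.coeff c i:] * [:0, 1:] ^ i)"
      using poly_as_sum_of_monoms[of c] by (simp add: monom_altdef)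
    then have "[:c:] = (\<Sum>i\<le>Polynomial.degree c. [:[:Polynomial.coeff c i:] * [:0, 1:] ^ i:])"
      by (metis cadd)
    also have "\<dots> = (\<Sum>i\<le>Polynomial.degree c. [:[:Polynomial.coeff c i:]:] * [:[:0, 1:]:] ^ i)"
      by (simp add: poly_const_pow)
    finally show "[:Polynomial.coeff p j:] * [:0, 1:] ^ j = (\<Sum>i\<le>Polynomial.degree (Polynomial.coeff p j).
        [:[:Polynomial.coeff (Polynomial.coeff p j) i:]:] * [:[:0, 1:]:] ^ i * [:0, 1:] ^ j)"
      by (simp only: c_def sum_distrib_right)
  qed
  finally have "Fraction_Field.Fract p 1 = Fraction_Field.Fract \<dots> 1"
    by (rule arg_cong)
  then show ?thesis
    by (simp only: add rf_cst_def rf_t_def rf_r_def pow[symmetric] mult_fract mult_1_right)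
qed

section \<open>The quotient algebras\<close>

text \<open>A single formula for the three relations, which are cyclic images of one
  another.\<close>

definition su2_relation :: "'k::field \<Rightarrow> gen \<Rightarrow> 'k free_alg" where
  "su2_relation h g = fgen g * fgen (next_gen g) - fgen (next_gen g) * fgen g -
     fcst h * fgen (next_gen (next_gen g))"

lemma env_relations_eq: "env_relations (h :: 'k::field) = range (su2_relation h)"
proof -
  have "range f = {f GX, f GY, f GZ}" for f :: "gen \<Rightarrow> 'k free_alg"
    by (auto, metis gen.exhaust)
  then show ?thesis by (simp add: env_relations_def su2_relation_def)
qed

lemma ideal_env: "ideal (env_ideal h) (free_ring :: 'k::field free_alg ring)"
  unfolding env_ideal_def by (rule free_ring.genideal_ideal) simp

interpretation env: ring "env h" for h
  unfolding env_def by (rule ideal.quotient_is_ring[OF ideal_env])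

interpretation env_proj: ring_hom_ring "free_ring :: 'k::field free_alg ring" "env h" "(+>\<^bsub>free_ring\<^esub>) (env_ideal h)" for h
  unfolding env_def by (rule ideal.rcos_ring_hom_ring[OF ideal_env])

lemma env_closed [simp]: "env_cst h c \<in> carrier (env h)" "env_gen h g \<in> carrier (env h)"
  using env_proj.hom_closed[of _ h] by (simp_all add: env_cst_def env_gen_def)

lemma (in abelian_group) eq_add_of_diff_eq_zero:
  assumes "a \<ominus> b \<ominus> c = \<zero>" "a \<in> carrier G" "b \<in> carrier G" "c \<in> carrier G"
  shows "a = b \<oplus> c"
proof -
  have "a \<oplus> \<ominus> (b \<oplus> c) = \<zero>"
    using assms by (simp add: minus_eq minus_add a_ac)
  then show ?thesis
    using assms by (metis a_closed a_inv_closed add.inv_equality minus_minus)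
qed

lemma (in abelian_group) add_minus_minus:
  assumes "a \<in> carrier G" "b \<in> carrier G"
  shows "(a \<oplus> b) \<ominus> a \<ominus> b = \<zero>"
proof -
  have "(a \<oplus> b) \<ominus> a \<ominus> b = (a \<oplus> b) \<oplus> \<ominus> (a \<oplus> b)"
    using assms by (simp add: minus_eq minus_add a_ac)
  then show ?thesis using assms by (simp add: r_neg)
qed

text \<open>Fitted to the generator of \<open>cas_ideal\<close>, with r^2 written as (r^2 - hbar^2)
  + hbar^2.\<close>

lemma (in ring) eq_of_minus_add_eq_zero:
  assumes "a \<ominus> (b \<oplus> c) \<oplus> c = \<zero>" "a \<in> carrier R" "b \<in> carrier R" "c \<in> carrier R"
  shows "a = b"
proof -
  have "a \<ominus> (b \<oplus> c) \<oplus> c = (a \<ominus> b) \<oplus> (\<ominus> c \<oplus> c)"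
    using assms(2-) by (simp add: minus_eq minus_add a_assoc)
  with assms have "a \<ominus> b = \<zero>"
    by (simp add: l_neg)
  then show ?thesis
    using assms(2,3) minus_equality[of a "\<ominus> b"] by (simp add: minus_eq)
qed

lemma env_gen_commutator:
  "env_gen h g \<otimes>\<^bsub>env h\<^esub> env_gen h (next_gen g) =
     env_gen h (next_gen g) \<otimes>\<^bsub>env h\<^esub> env_gen h g \<oplus>\<^bsub>env h\<^esub>
     env_cst h h \<otimes>\<^bsub>env h\<^esub> env_gen h (next_gen (next_gen g))"
proof (rule env.eq_add_of_diff_eq_zero)
  have "su2_relation h g \<in> env_ideal h"
    unfolding env_ideal_def env_relations_eq
    by (rule subsetD[OF free_ring.genideal_self rangeI]) simp
  then have "env_ideal h +>\<^bsub>free_ring\<^esub> su2_relation h g = \<zero>\<^bsub>env h\<^esub>"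
    unfolding env_def by (rule ideal.quot_eq_zero[OF ideal_env])
  moreover have "env_ideal h +>\<^bsub>free_ring\<^esub> (a - b) =
      (env_ideal h +>\<^bsub>free_ring\<^esub> a) \<ominus>\<^bsub>env h\<^esub> (env_ideal h +>\<^bsub>free_ring\<^esub> b)" for a b
    using env_proj.hom_a_minus[of a b] by simp
  moreover have "env_ideal h +>\<^bsub>free_ring\<^esub> (a * b) =
      (env_ideal h +>\<^bsub>free_ring\<^esub> a) \<otimes>\<^bsub>env h\<^esub> (env_ideal h +>\<^bsub>free_ring\<^esub> b)" for a b
    using env_proj.hom_mult[of a b] by simp
  ultimately show "env_gen h g \<otimes>\<^bsub>env h\<^esub> env_gen h (next_gen g) \<ominus>\<^bsub>env h\<^esub>
      env_gen h (next_gen g) \<otimes>\<^bsub>env h\<^esub> env_gen h g \<ominus>\<^bsub>env h\<^esub>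
      env_cst h h \<otimes>\<^bsub>env h\<^esub> env_gen h (next_gen (next_gen g)) = \<zero>\<^bsub>env h\<^esub>"
    by (simp add: su2_relation_def env_gen_def env_cst_def)
qed simp_all

lemma env_carrier: "carrier (env h) = range ((+>\<^bsub>free_ring\<^esub>) (env_ideal h))"
  unfolding env_def ideal.quot_carrier[OF ideal_env] by simp

lemma ring_hom_env_eqI:
  assumes f: "f \<in> Ring.ring_hom (env h) S" and g: "g \<in> Ring.ring_hom (env h) S"
    and cst: "\<And>c. f (env_cst h c) = g (env_cst h c)" and gen: "\<And>i. f (env_gen h i) = g (env_gen h i)"
    and a: "a \<in> carrier (env h)"
  shows "f a = g a"
proof -
  obtain p where p: "a = env_ideal h +>\<^bsub>free_ring\<^esub> p"
    using a by (auto simp: env_carrier)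
  have "(f \<circ> (+>\<^bsub>free_ring\<^esub>) (env_ideal h)) p = (g \<circ> (+>\<^bsub>free_ring\<^esub>) (env_ideal h)) p"
    by (rule ring_hom_free_eqI[OF ring_hom_trans[OF env_proj.homh f] ring_hom_trans[OF env_proj.homh g]])
       (use cst gen in \<open>simp_all add: env_cst_def env_gen_def\<close>)
  then show ?thesis by (simp add: p)
qed

text \<open>The universal property of the enveloping algebra. It provides \<Theta> on U(su(2)), the
  canonical map into the quotient algebra, and \<Theta> on the scalar extension.\<close>

locale env_eval = free_eval S \<kappa> \<gamma>
  for S :: "('s, 'm) ring_scheme" (structure) and \<kappa> :: "'k::field \<Rightarrow> 's" and \<gamma> +
  fixes h :: 'k
  assumes \<gamma>_commutator: "\<gamma> g \<otimes> \<gamma> (next_gen g) =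
    \<gamma> (next_gen g) \<otimes> \<gamma> g \<oplus> \<kappa> h \<otimes> \<gamma> (next_gen (next_gen g))"
begin

lemma ev_ring_hom_ring: "ring_hom_ring free_ring S ev"
  by (rule ring_hom_ringI2[OF ring_free_ring ring_axioms ev_ring_hom])

lemma quot_hom_ev: "quot_hom (env_ideal h) free_ring S ev"
  unfolding env_ideal_def
proof (rule quot_hom_Idl[OF ev_ring_hom_ring])
  interpret ev: ring_hom_ring free_ring S ev by (rule ev_ring_hom_ring)
  have ev_diff: "ev (p - q) = ev p \<ominus> ev q" for p q
    using ev.hom_a_minus[of p q] by simp
  have "ev (su2_relation h g) = \<zero>" for g
    by (simp add: su2_relation_def ev_diff ev_mult \<gamma>_commutator add_minus_minus)
  then show "ev p = \<zero>" if "p \<in> env_relations h" for p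
    using that by (auto simp: env_relations_eq)
qed simp

lemma induced_ring_hom: "induced S \<kappa> \<gamma> \<in> Ring.ring_hom (env h) S"
  using quot_hom.quot_ring_hom[OF quot_hom_ev] unfolding env_def induced_def[abs_def] .

lemma induced_coset: "induced S \<kappa> \<gamma> (env_ideal h +>\<^bsub>free_ring\<^esub> p) = ev p"
  unfolding induced_def by (rule quot_hom.the_elem_coset[OF quot_hom_ev]) simp

lemma induced_cst [simp]: "induced S \<kappa> \<gamma> (env_cst h c) = \<kappa> c"
  and induced_gen [simp]: "induced S \<kappa> \<gamma> (env_gen h g) = \<gamma> g"
  by (simp_all add: env_cst_def env_gen_def induced_coset)

end

section \<open>The quotient algebra: central scalars, brackets and the Casimir relation\<close>

context
  fixes hbar :: complex
begin

abbreviation "cas_element \<equiv>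
  env_cas (rf_cst (planck hbar)) \<ominus>\<^bsub>U_su2_ext hbar\<^esub> env_cst (rf_cst (planck hbar)) (rf_r ^ 2)
    \<oplus>\<^bsub>U_su2_ext hbar\<^esub> env_cst (rf_cst (planck hbar)) (rf_cst (hbar ^ 2))"

lemma env_cas_closed [simp]: "env_cas h \<in> carrier (env h)"
  by (simp add: env_cas_def)

lemma ideal_cas: "ideal (cas_ideal hbar) (U_su2_ext hbar)"
  unfolding cas_ideal_def Let_def by (rule env.genideal_ideal) simp

interpretation qalg: ring "qalg hbar"
  unfolding qalg_def by (rule ideal.quotient_is_ring[OF ideal_cas])

interpretation q_proj: ring_hom_ring "U_su2_ext hbar" "qalg hbar" "(+>\<^bsub>U_su2_ext hbar\<^esub>) (cas_ideal hbar)"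
  unfolding qalg_def by (rule ideal.rcos_ring_hom_ring[OF ideal_cas])

lemma q_closed [simp]: "q_cst hbar f \<in> carrier (qalg hbar)" "q_gen hbar g \<in> carrier (qalg hbar)"
  by (simp_all add: q_cst_def q_gen_def)

lemma qalg_carrier: "carrier (qalg hbar) = (+>\<^bsub>U_su2_ext hbar\<^esub>) (cas_ideal hbar) ` carrier (U_su2_ext hbar)"
  unfolding qalg_def by (rule ideal.quot_carrier[OF ideal_cas])

lemma ring_hom_qalg_eqI:
  assumes f: "f \<in> Ring.ring_hom (qalg hbar) S" and g: "g \<in> Ring.ring_hom (qalg hbar) S"
    and cst: "\<And>c. f (q_cst hbar c) = g (q_cst hbar c)" and gen: "\<And>i. f (q_gen hbar i) = g (q_gen hbar i)"
    and a: "a \<in> carrier (qalg hbar)"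
  shows "f a = g a"
proof -
  let ?\<pi> = "(+>\<^bsub>U_su2_ext hbar\<^esub>) (cas_ideal hbar)"
  obtain b where b: "a = ?\<pi> b" "b \<in> carrier (U_su2_ext hbar)"
    using a by (auto simp: qalg_carrier)
  have "(f \<circ> ?\<pi>) b = (g \<circ> ?\<pi>) b"
    by (rule ring_hom_env_eqI[OF ring_hom_trans[OF q_proj.homh f] ring_hom_trans[OF q_proj.homh g] _ _ b(2)])
       (use cst gen in \<open>simp_all add: q_cst_def q_gen_def\<close>)
  then show ?thesis by (simp add: b)
qed

lemma q_cst_add: "q_cst hbar (f + g) = q_cst hbar f \<oplus>\<^bsub>qalg hbar\<^esub> q_cst hbar g"
  and q_cst_mult: "q_cst hbar (f * g) = q_cst hbar f \<otimes>\<^bsub>qalg hbar\<^esub> q_cst hbar g"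
  and q_cst_1: "q_cst hbar 1 = \<one>\<^bsub>qalg hbar\<^esub>"
proof -
  note \<rho> = ring_hom_trans[OF env_proj.homh q_proj.homh]
  let ?\<rho> = "(+>\<^bsub>U_su2_ext hbar\<^esub>) (cas_ideal hbar) \<circ>
    (+>\<^bsub>free_ring\<^esub>) (env_ideal (rf_cst (planck hbar)))"
  have q: "q_cst hbar f = ?\<rho> (fcst f)" for f
    by (simp add: q_cst_def env_cst_def)
  show "q_cst hbar (f + g) = q_cst hbar f \<oplus>\<^bsub>qalg hbar\<^esub> q_cst hbar g"
    using ring_hom_add[OF \<rho>, of "fcst f" "fcst g"] by (simp only: q fcst_add free_ring_simps UNIV_I)
  show "q_cst hbar (f * g) = q_cst hbar f \<otimes>\<^bsub>qalg hbar\<^esub> q_cst hbar g"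
    using ring_hom_mult[OF \<rho>, of "fcst f" "fcst g"] by (simp only: q fcst_mult free_ring_simps UNIV_I)
  show "q_cst hbar 1 = \<one>\<^bsub>qalg hbar\<^esub>"
    using ring_hom_one[OF \<rho>] by (simp only: q fcst_1 free_ring_simps)
qed

lemma q_cst_0: "q_cst hbar 0 = \<zero>\<^bsub>qalg hbar\<^esub>"
  using q_cst_add[of 0 0] by (metis add_0 q_closed(1) qalg.add.r_cancel_one')

lemma q_cst_minus: "q_cst hbar (- f) = \<ominus>\<^bsub>qalg hbar\<^esub> q_cst hbar f"
  by (rule qalg.minus_equality[symmetric]) (simp_all add: q_cst_0 flip: q_cst_add)

text \<open>Scalars are central already in the free algebra, and every element of the quotient is
  the image of a free one.\<close>

lemma q_cst_central:
  assumes "a \<in> carrier (qalg hbar)"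
  shows "a \<otimes>\<^bsub>qalg hbar\<^esub> q_cst hbar f = q_cst hbar f \<otimes>\<^bsub>qalg hbar\<^esub> a"
proof -
  note \<rho> = ring_hom_trans[OF env_proj.homh q_proj.homh]
  let ?\<rho> = "(+>\<^bsub>U_su2_ext hbar\<^esub>) (cas_ideal hbar) \<circ>
    (+>\<^bsub>free_ring\<^esub>) (env_ideal (rf_cst (planck hbar)))"
  obtain p where p: "a = ?\<rho> p"
    using assms by (auto simp: qalg_carrier env_carrier)
  have q: "q_cst hbar f = ?\<rho> (fcst f)"
    by (simp add: q_cst_def env_cst_def)
  show ?thesis
    using ring_hom_mult[OF \<rho>, of "fcst f" p] ring_hom_mult[OF \<rho>, of p "fcst f"]
    by (simp only: p q free_ring_simps UNIV_I fcst_commute[of f p])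
qed

lemma q_gen_commutator:
  "q_gen hbar g \<otimes>\<^bsub>qalg hbar\<^esub> q_gen hbar (next_gen g) =
     q_gen hbar (next_gen g) \<otimes>\<^bsub>qalg hbar\<^esub> q_gen hbar g \<oplus>\<^bsub>qalg hbar\<^esub>
     q_cst hbar (rf_cst (planck hbar)) \<otimes>\<^bsub>qalg hbar\<^esub> q_gen hbar (next_gen (next_gen g))"
  unfolding q_gen_def q_cst_def
  by (simp add: env_gen_commutator flip: q_proj.hom_mult q_proj.hom_add)

lemma q_gen_cas:
  "q_gen hbar GX \<otimes>\<^bsub>qalg hbar\<^esub> q_gen hbar GX \<oplus>\<^bsub>qalg hbar\<^esub>
   q_gen hbar GY \<otimes>\<^bsub>qalg hbar\<^esub> q_gen hbar GY \<oplus>\<^bsub>qalg hbar\<^esub>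
   q_gen hbar GZ \<otimes>\<^bsub>qalg hbar\<^esub> q_gen hbar GZ =
   q_cst hbar (rf_r * rf_r - rf_cst hbar * rf_cst hbar)"
  (is "?C = _")
proof -
  let ?\<pi> = "(+>\<^bsub>U_su2_ext hbar\<^esub>) (cas_ideal hbar)"
  have "cas_element \<in> cas_ideal hbar"
    unfolding cas_ideal_def Let_def by (rule env.genideal_self') simp
  then have "?\<pi> cas_element = \<zero>\<^bsub>qalg hbar\<^esub>"
    unfolding qalg_def by (rule ideal.quot_eq_zero[OF ideal_cas])
  moreover have "?\<pi> (env_cas (rf_cst (planck hbar))) = ?C"
    by (simp add: env_cas_def q_gen_def numeral_2_eq_2)
  ultimately have 0: "?C \<ominus>\<^bsub>qalg hbar\<^esub> q_cst hbar (rf_r ^ 2) \<oplus>\<^bsub>qalg hbar\<^esub> q_cst hbar (rf_cst (hbar ^ 2)) =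
      \<zero>\<^bsub>qalg hbar\<^esub>"
    by (simp add: q_cst_def)
  define c where "c = q_cst hbar (rf_r * rf_r - rf_cst hbar * rf_cst hbar)"
  have "q_cst hbar (rf_r ^ 2) = c \<oplus>\<^bsub>qalg hbar\<^esub> q_cst hbar (rf_cst (hbar ^ 2))"
    unfolding c_def q_cst_add[symmetric] by (simp add: power2_eq_square rf_cst_mult)
  with 0 have "?C \<ominus>\<^bsub>qalg hbar\<^esub> (c \<oplus>\<^bsub>qalg hbar\<^esub> q_cst hbar (rf_cst (hbar ^ 2)))
      \<oplus>\<^bsub>qalg hbar\<^esub> q_cst hbar (rf_cst (hbar ^ 2)) = \<zero>\<^bsub>qalg hbar\<^esub>"
    by (simp only:)
  then have "?C = c"
    by (rule qalg.eq_of_minus_add_eq_zero) (simp_all add: c_def)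
  then show ?thesis by (simp only: c_def)
qed

end

section \<open>The extension of \<open>\<Theta>\<close>\<close>

text \<open>The involution \<open>J\<close> is obtained by dividing by hbar.\<close>

locale nonzero_planck =
  fixes hbar :: complex
  assumes hbar: "hbar \<noteq> 0"
begin

section \<open>The two commuting triples realised by matrices\<close>

interpretation qalg: ring "qalg hbar"
  unfolding qalg_def by (rule ideal.quotient_is_ring[OF ideal_cas])

interpretation M: ring "Mat4 hbar"
  by (rule qalg.ring_mat_alg)

interpretation sc: ring_hom_ring "qalg hbar" "Mat4 hbar" "scalar_mat 4 (qalg hbar)"
  by (rule ring_hom_ringI2[OF qalg.ring_axioms M.ring_axioms qalg.scalar_mat_ring_hom])

abbreviation Z :: "ratfun \<Rightarrow> ratfun free_alg set set mat" where
  "Z f \<equiv> scalar_mat 4 (qalg hbar) (q_cst hbar f)"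

abbreviation u :: ratfun where "u \<equiv> rf_cst (\<i> * hbar)"
abbreviation v :: ratfun where "v \<equiv> rf_cst hbar"
abbreviation X :: "gen \<Rightarrow> ratfun free_alg set set mat" where
  "X g \<equiv> scalar_mat 4 (qalg hbar) (q_gen hbar g)"
abbreviation D :: "gen \<Rightarrow> ratfun free_alg set set mat" where
  "D g \<equiv> Z u \<otimes>\<^bsub>Mat4 hbar\<^esub> qalg.quat g"

lemma u_sq: "u * u = - (v * v)"
proof -
  have "\<i> * hbar * (\<i> * hbar) = - (hbar * hbar)"
    by (simp add: mult.assoc mult.left_commute[of hbar])
  then show ?thesis by (simp only: rf_cst_mult[symmetric] rf_cst_minus[symmetric])
qed

lemma planck_eq: "rf_cst (planck hbar) = 2 * u"
  by (simp add: planck_def mult.assoc rf_cst_mult[of 2] rf_cst_2)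

interpretation Z: central_hom "Mat4 hbar" Z
proof
  fix a f assume "a \<in> carrier (Mat4 hbar)"
  then show "a \<otimes>\<^bsub>Mat4 hbar\<^esub> Z f = Z f \<otimes>\<^bsub>Mat4 hbar\<^esub> a"
    by (intro qalg.scalar_mat_commute[symmetric] q_closed q_cst_central[symmetric])
       (simp_all add: qalg.mat_alg_entry_closed[where n = 4])
qed (simp_all add: q_cst_add q_cst_mult q_cst_1)

lemma quat_X: "qalg.quat g \<otimes>\<^bsub>Mat4 hbar\<^esub> X g' = X g' \<otimes>\<^bsub>Mat4 hbar\<^esub> qalg.quat g"
proof (rule qalg.scalar_mat_commute[symmetric])
  fix i j :: nat assume "i < 4" "j < 4"
  then show "q_gen hbar g' \<otimes>\<^bsub>qalg hbar\<^esub> qalg.quat g $$ (i, j) =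
      qalg.quat g $$ (i, j) \<otimes>\<^bsub>qalg hbar\<^esub> q_gen hbar g'"
    using qalg.quat_index[of i j g] by (auto simp: qalg.l_minus qalg.r_minus)
qed simp_all

lemma D_mult: "D g \<otimes>\<^bsub>Mat4 hbar\<^esub> D g' = Z (- (v * v)) \<otimes>\<^bsub>Mat4 hbar\<^esub> (qalg.quat g \<otimes>\<^bsub>Mat4 hbar\<^esub> qalg.quat g')"
  by (simp add: M.m_assoc Z.Z_lcomm[OF qalg.quat_closed] Z.Z_Z u_sq)

lemma quat_mult_cyclic:
  "qalg.quat g \<otimes>\<^bsub>Mat4 hbar\<^esub> qalg.quat g = \<ominus>\<^bsub>Mat4 hbar\<^esub> \<one>\<^bsub>Mat4 hbar\<^esub>"
  "qalg.quat g \<otimes>\<^bsub>Mat4 hbar\<^esub> qalg.quat (next_gen g) = qalg.quat (next_gen (next_gen g))"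
  "qalg.quat (next_gen g) \<otimes>\<^bsub>Mat4 hbar\<^esub> qalg.quat g = \<ominus>\<^bsub>Mat4 hbar\<^esub> qalg.quat (next_gen (next_gen g))"
  by (cases g; simp add: qalg.quat_mult)+

text \<open>Both shifts send t to t + i hbar and differ only in r, which goes to r + hbar or r -
  hbar; so t keeps a scalar image while r does not.\<close>

interpretation \<Theta>: quat_su2_shift "Mat4 hbar" Z X D u v rf_r "shift (\<i> * hbar) hbar" "shift (\<i> * hbar) (- hbar)"
proof
  fix g g'
  show "X g \<in> carrier (Mat4 hbar)" "D g \<in> carrier (Mat4 hbar)"
    by simp_all
  show "D g \<otimes>\<^bsub>Mat4 hbar\<^esub> X g' = X g' \<otimes>\<^bsub>Mat4 hbar\<^esub> D g"
    by (simp add: M.m_assoc quat_X Z.Z_lcomm[OF sc.hom_closed])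
  show "X g \<otimes>\<^bsub>Mat4 hbar\<^esub> X (next_gen g) =
      X (next_gen g) \<otimes>\<^bsub>Mat4 hbar\<^esub> X g \<oplus>\<^bsub>Mat4 hbar\<^esub> Z (2 * u) \<otimes>\<^bsub>Mat4 hbar\<^esub> X (next_gen (next_gen g))"
    by (simp add: q_gen_commutator planck_eq flip: sc.hom_mult sc.hom_add)
  show "D g \<otimes>\<^bsub>Mat4 hbar\<^esub> D g = Z (v * v)"
    unfolding D_mult quat_mult_cyclic by (simp add: Z.Z_minus M.l_minus M.r_minus)
  \<comment> \<open>Both sides of the product rules for \<open>D\<close> become multiples of a
    quaternion unit by -v^2.\<close>
  have Zu: "Z u \<otimes>\<^bsub>Mat4 hbar\<^esub> D w = Z (- (v * v)) \<otimes>\<^bsub>Mat4 hbar\<^esub> qalg.quat w" for w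
    by (simp add: Z.Z_Z u_sq)
  show "D g \<otimes>\<^bsub>Mat4 hbar\<^esub> D (next_gen g) = Z u \<otimes>\<^bsub>Mat4 hbar\<^esub> D (next_gen (next_gen g))"
    unfolding D_mult quat_mult_cyclic Zu ..
  show "D (next_gen g) \<otimes>\<^bsub>Mat4 hbar\<^esub> D g = \<ominus>\<^bsub>Mat4 hbar\<^esub> (Z u \<otimes>\<^bsub>Mat4 hbar\<^esub> D (next_gen (next_gen g)))"
    unfolding D_mult quat_mult_cyclic Zu by (simp add: M.r_minus)
  show "u * u = - (v * v)" by (rule u_sq)
  show "X GX \<otimes>\<^bsub>Mat4 hbar\<^esub> X GX \<oplus>\<^bsub>Mat4 hbar\<^esub> X GY \<otimes>\<^bsub>Mat4 hbar\<^esub> X GY \<oplus>\<^bsub>Mat4 hbar\<^esub>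
      X GZ \<otimes>\<^bsub>Mat4 hbar\<^esub> X GZ = Z (rf_r * rf_r - v * v)"
    by (simp add: q_gen_cas flip: sc.hom_mult sc.hom_add)
qed (use hbar rf_r_nonzero rf_cst_eq_0[of 2] in
  \<open>simp_all add: shift_add shift_mult shift_r rf_cst_minus rf_cst_2\<close>)

abbreviation "\<phi> \<equiv> \<Theta>.\<phi>"
abbreviation "Y \<equiv> \<Theta>.y"

lemma Theta_gen_eq: "Theta_gen hbar g = Y g"
proof (rule qalg.mat_alg_eqI[where n = 4])
  have T: "Theta_gen hbar g \<in> carrier_mat 4 4"
    by (cases g; rule carrier_matI) (simp_all add: Theta_gen_def Let_def mat_of_rows_list_def)
  have m: "q_cst hbar (rf_cst (- \<i> * hbar)) = \<ominus>\<^bsub>qalg hbar\<^esub> q_cst hbar u"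
    by (simp add: rf_cst_minus q_cst_minus)
  have X: "Theta_gen hbar GX $$ (i, j) =
      [[q_gen hbar GX, \<ominus>\<^bsub>qalg hbar\<^esub> q_cst hbar u, \<zero>\<^bsub>qalg hbar\<^esub>, \<zero>\<^bsub>qalg hbar\<^esub>],
       [q_cst hbar u, q_gen hbar GX, \<zero>\<^bsub>qalg hbar\<^esub>, \<zero>\<^bsub>qalg hbar\<^esub>],
       [\<zero>\<^bsub>qalg hbar\<^esub>, \<zero>\<^bsub>qalg hbar\<^esub>, q_gen hbar GX, \<ominus>\<^bsub>qalg hbar\<^esub> q_cst hbar u],
       [\<zero>\<^bsub>qalg hbar\<^esub>, \<zero>\<^bsub>qalg hbar\<^esub>, q_cst hbar u, q_gen hbar GX]] ! i ! j"
    and Y: "Theta_gen hbar GY $$ (i, j) =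
      [[q_gen hbar GY, \<zero>\<^bsub>qalg hbar\<^esub>, \<ominus>\<^bsub>qalg hbar\<^esub> q_cst hbar u, \<zero>\<^bsub>qalg hbar\<^esub>],
       [\<zero>\<^bsub>qalg hbar\<^esub>, q_gen hbar GY, \<zero>\<^bsub>qalg hbar\<^esub>, q_cst hbar u],
       [q_cst hbar u, \<zero>\<^bsub>qalg hbar\<^esub>, q_gen hbar GY, \<zero>\<^bsub>qalg hbar\<^esub>],
       [\<zero>\<^bsub>qalg hbar\<^esub>, \<ominus>\<^bsub>qalg hbar\<^esub> q_cst hbar u, \<zero>\<^bsub>qalg hbar\<^esub>, q_gen hbar GY]] ! i ! j"
    and Z: "Theta_gen hbar GZ $$ (i, j) =
      [[q_gen hbar GZ, \<zero>\<^bsub>qalg hbar\<^esub>, \<zero>\<^bsub>qalg hbar\<^esub>, \<ominus>\<^bsub>qalg hbar\<^esub> q_cst hbar u],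
       [\<zero>\<^bsub>qalg hbar\<^esub>, q_gen hbar GZ, \<ominus>\<^bsub>qalg hbar\<^esub> q_cst hbar u, \<zero>\<^bsub>qalg hbar\<^esub>],
       [\<zero>\<^bsub>qalg hbar\<^esub>, q_cst hbar u, q_gen hbar GZ, \<zero>\<^bsub>qalg hbar\<^esub>],
       [q_cst hbar u, \<zero>\<^bsub>qalg hbar\<^esub>, \<zero>\<^bsub>qalg hbar\<^esub>, q_gen hbar GZ]] ! i ! j"
    if "i < 4" "j < 4" for i j
    using that unfolding Theta_gen_def Let_def m gen.case mat_of_rows_list_def by simp_all
  have Yg: "Y g $$ (i, j) = (if i = j then q_gen hbar g else \<zero>\<^bsub>qalg hbar\<^esub>) \<oplus>\<^bsub>qalg hbar\<^esub>
      q_cst hbar u \<otimes>\<^bsub>qalg hbar\<^esub> qalg.quat g $$ (i, j)"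
    if "i < 4" "j < 4" for i j
    using that
    by (simp only: \<Theta>.y_def qalg.mat_alg_index(2) qalg.scalar_mat_index
      qalg.scalar_mat_mult_index(1)[OF q_closed(1) qalg.quat_closed])
  show eq: "Theta_gen hbar g $$ (i, j) = Y g $$ (i, j)" if "i < 4" "j < 4" for i j
    unfolding Yg[OF that] using that
    by (cases g; elim less_4_cases) (simp_all add: X Y Z qalg.quat_entry qalg.r_minus)
  \<comment> \<open>Membership is inherited from \<open>Y g\<close> through the equality of
    entries.\<close>
  then show "Theta_gen hbar g \<in> carrier (Mat4 hbar)"
    unfolding qalg.mat_alg_carrier using T qalg.mat_alg_entry_closed[OF \<Theta>.y_closed] by auto
qed simp


lemma Theta_t_eq: "Theta_t hbar = \<phi> rf_t"
  unfolding Theta_t_def by (rule \<Theta>.\<phi>_fixed[symmetric]) (simp_all add: shift_t)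

text \<open>By \<open>\<Theta>.\<phi>_r\<close>, with the scalar i hbar pulled out of
  \<open>\<Theta>.N\<close>, the off-diagonal entries are i hbar times signed generators and the
  diagonal is r^2 + hbar^2, all divided by r.\<close>

lemma Theta_r_eq: "Theta_r hbar = \<phi> rf_r"
proof (rule qalg.mat_alg_eqI[where n = 4])
  have N: "\<Theta>.N = Z u \<otimes>\<^bsub>Mat4 hbar\<^esub> (X GX \<otimes>\<^bsub>Mat4 hbar\<^esub> qalg.quat GX \<oplus>\<^bsub>Mat4 hbar\<^esub>
      X GY \<otimes>\<^bsub>Mat4 hbar\<^esub> qalg.quat GY \<oplus>\<^bsub>Mat4 hbar\<^esub> X GZ \<otimes>\<^bsub>Mat4 hbar\<^esub> qalg.quat GZ)"
    by (simp add: \<Theta>.N_def \<Theta>.x_Z M.r_distr)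
  have T: "Theta_r hbar \<in> carrier_mat 4 4"
    by (rule carrier_matI) (simp_all add: Theta_r_def Let_def mat_of_rows_list_def)
  have d: "rf_r ^ 2 + rf_cst (hbar ^ 2) = rf_r * rf_r + v * v"
    by (simp add: power2_eq_square rf_cst_mult)
  show eq: "Theta_r hbar $$ (i, j) = \<phi> rf_r $$ (i, j)" if "i < 4" "j < 4" for i j
    using that unfolding \<Theta>.\<phi>_r N
    by (elim less_4_cases)
       (simp_all add: Theta_r_def Let_def mat_of_rows_list_def d rf_cst_minus q_cst_minus qalg.scalar_mat_index
         qalg.quat_entry qalg.r_minus qalg.l_minus del: qalg.mat_alg_index(1))
  then show "Theta_r hbar \<in> carrier (Mat4 hbar)"
    unfolding qalg.mat_alg_carrier using T qalg.mat_alg_entry_closed[OF \<Theta>.\<phi>_closed] by auto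
qed simp

lemma m_cst_eq: "m_cst hbar c = Z (rf_cst c)"
  by (simp add: m_cst_def)

lemma \<phi>_cst: "\<phi> (rf_cst c) = m_cst hbar c"
  unfolding m_cst_eq by (rule \<Theta>.\<phi>_fixed) (simp_all add: shift_cst)

interpretation \<Theta>U: env_eval "Mat4 hbar" "m_cst hbar" "Theta_gen hbar" "planck hbar"
proof
  fix c d g
  show "m_cst hbar c \<in> carrier (Mat4 hbar)" "m_cst hbar 1 = \<one>\<^bsub>Mat4 hbar\<^esub>"
    "Theta_gen hbar g \<in> carrier (Mat4 hbar)"
    by (simp_all add: m_cst_eq Theta_gen_eq)
  show "m_cst hbar (c + d) = m_cst hbar c \<oplus>\<^bsub>Mat4 hbar\<^esub> m_cst hbar d"
    "m_cst hbar (c * d) = m_cst hbar c \<otimes>\<^bsub>Mat4 hbar\<^esub> m_cst hbar d"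
    by (simp_all only: m_cst_eq rf_cst_add rf_cst_mult Z.Z_add Z.Z_mult)
  show "m_cst hbar c \<otimes>\<^bsub>Mat4 hbar\<^esub> Theta_gen hbar g = Theta_gen hbar g \<otimes>\<^bsub>Mat4 hbar\<^esub> m_cst hbar c"
    by (simp add: m_cst_eq Theta_gen_eq \<Theta>.y_Z)
  show "Theta_gen hbar g \<otimes>\<^bsub>Mat4 hbar\<^esub> Theta_gen hbar (next_gen g) =
    Theta_gen hbar (next_gen g) \<otimes>\<^bsub>Mat4 hbar\<^esub> Theta_gen hbar g \<oplus>\<^bsub>Mat4 hbar\<^esub>
    m_cst hbar (planck hbar) \<otimes>\<^bsub>Mat4 hbar\<^esub> Theta_gen hbar (next_gen (next_gen g))"
    unfolding m_cst_eq Theta_gen_eq planck_eq by (rule \<Theta>.yy)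
qed

text \<open>The coefficient map is now \<open>\<phi>\<close>; commutation with \<open>Y\<close>
  takes the place of centrality.\<close>

interpretation \<Theta>e: env_eval "Mat4 hbar" \<phi> Y "rf_cst (planck hbar)"
proof
  fix f g i
  show "\<phi> (f + g) = \<phi> f \<oplus>\<^bsub>Mat4 hbar\<^esub> \<phi> g" by (rule \<Theta>.\<phi>_add)
  show "\<phi> (f * g) = \<phi> f \<otimes>\<^bsub>Mat4 hbar\<^esub> \<phi> g" by (rule \<Theta>.\<phi>_mult)
  show "\<phi> f \<otimes>\<^bsub>Mat4 hbar\<^esub> Y i = Y i \<otimes>\<^bsub>Mat4 hbar\<^esub> \<phi> f" by (rule \<Theta>.\<phi>_y_commute)
  show "Y i \<otimes>\<^bsub>Mat4 hbar\<^esub> Y (next_gen i) = Y (next_gen i) \<otimes>\<^bsub>Mat4 hbar\<^esub> Y i \<oplus>\<^bsub>Mat4 hbar\<^esub>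
      \<phi> (rf_cst (planck hbar)) \<otimes>\<^bsub>Mat4 hbar\<^esub> Y (next_gen (next_gen i))"
    unfolding \<phi>_cst m_cst_eq unfolding planck_eq by (rule \<Theta>.yy)
qed simp_all

interpretation qi: env_eval "qalg hbar" "\<lambda>c. q_cst hbar (rf_cst c)" "q_gen hbar" "planck hbar"
proof
  fix c d g
  show "q_cst hbar (rf_cst c) \<otimes>\<^bsub>qalg hbar\<^esub> q_gen hbar g = q_gen hbar g \<otimes>\<^bsub>qalg hbar\<^esub> q_cst hbar (rf_cst c)"
    by (rule q_cst_central[symmetric]) simp
  show "q_gen hbar g \<otimes>\<^bsub>qalg hbar\<^esub> q_gen hbar (next_gen g) =
     q_gen hbar (next_gen g) \<otimes>\<^bsub>qalg hbar\<^esub> q_gen hbar g \<oplus>\<^bsub>qalg hbar\<^esub>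
     q_cst hbar (rf_cst (planck hbar)) \<otimes>\<^bsub>qalg hbar\<^esub> q_gen hbar (next_gen (next_gen g))"
    by (rule q_gen_commutator)
qed (simp_all add: rf_cst_add rf_cst_mult q_cst_add q_cst_mult q_cst_1)

section \<open>Construction of the extended map and substitution into fractions\<close>

lemma Theta_U_hom: "Theta_U hbar \<in> Ring.ring_hom (U_su2 hbar) (Mat4 hbar)"
  unfolding Theta_U_def by (rule \<Theta>U.induced_ring_hom)

lemma Theta_U_cst: "Theta_U hbar (env_cst (planck hbar) c) = m_cst hbar c"
  and Theta_U_gen: "Theta_U hbar (env_gen (planck hbar) g) = Theta_gen hbar g"
  by (simp_all add: Theta_U_def)

text \<open>The candidate on the scalar extension, before the Casimir relation is divided
  out.\<close>

definition ext :: "ratfun free_alg set \<Rightarrow> ratfun free_alg set set mat" where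
  "ext = induced (Mat4 hbar) \<phi> Y"

interpretation ext: ring_hom_ring "U_su2_ext hbar" "Mat4 hbar" ext
  unfolding ext_def
  by (rule ring_hom_ringI2[OF env.ring_axioms M.ring_axioms \<Theta>e.induced_ring_hom])

lemma ext_cst [simp]: "ext (env_cst (rf_cst (planck hbar)) f) = \<phi> f"
  and ext_gen [simp]: "ext (env_gen (rf_cst (planck hbar)) g) = Y g"
  by (simp_all add: ext_def)

text \<open>By \<open>\<Theta>.\<phi>_r_sq\<close>, the generator goes to C - (v^2 + C) + v^2 = 0,
  where C is the Casimir expression in \<open>Y\<close>.\<close>

lemma ext_cas_ideal: "quot_hom (cas_ideal hbar) (U_su2_ext hbar) (Mat4 hbar) ext"
  unfolding cas_ideal_def Let_def
proof (rule quot_hom_Idl[OF ext.is_ring_hom_ring])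
  let ?C = "Y GX \<otimes>\<^bsub>Mat4 hbar\<^esub> Y GX \<oplus>\<^bsub>Mat4 hbar\<^esub> Y GY \<otimes>\<^bsub>Mat4 hbar\<^esub> Y GY
    \<oplus>\<^bsub>Mat4 hbar\<^esub> Y GZ \<otimes>\<^bsub>Mat4 hbar\<^esub> Y GZ"
  have "ext (env_cas (rf_cst (planck hbar))) = ?C"
    by (simp add: env_cas_def numeral_2_eq_2)
  moreover have "\<phi> (rf_r ^ 2) = Z (v * v) \<oplus>\<^bsub>Mat4 hbar\<^esub> ?C"
    unfolding power2_eq_square by (rule \<Theta>.\<phi>_r_sq)
  moreover have "\<phi> (rf_cst (hbar ^ 2)) = Z (v * v)"
    unfolding \<phi>_cst m_cst_eq by (simp add: power2_eq_square rf_cst_mult)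
  ultimately have "ext (cas_element hbar) =
      ?C \<ominus>\<^bsub>Mat4 hbar\<^esub> (Z (v * v) \<oplus>\<^bsub>Mat4 hbar\<^esub> ?C) \<oplus>\<^bsub>Mat4 hbar\<^esub> Z (v * v)"
    by simp
  also have "\<dots> = (Z (v * v) \<oplus>\<^bsub>Mat4 hbar\<^esub> ?C) \<oplus>\<^bsub>Mat4 hbar\<^esub> \<ominus>\<^bsub>Mat4 hbar\<^esub> (Z (v * v) \<oplus>\<^bsub>Mat4 hbar\<^esub> ?C)"
    by (simp add: M.minus_eq M.a_ac del: qalg.mat_alg_index)
  also have "\<dots> = \<zero>\<^bsub>Mat4 hbar\<^esub>"
    by (rule M.r_neg) simp
  finally show "ext a = \<zero>\<^bsub>Mat4 hbar\<^esub>" if "a \<in> {cas_element hbar}" for a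
    using that by simp
qed simp

definition Theta :: "ratfun free_alg set set \<Rightarrow> ratfun free_alg set set mat" where
  "Theta A = the_elem (ext ` A)"

lemma Theta_hom: "Theta \<in> Ring.ring_hom (qalg hbar) (Mat4 hbar)"
  using quot_hom.quot_ring_hom[OF ext_cas_ideal] unfolding qalg_def Theta_def[abs_def] .

lemma Theta_cst [simp]: "Theta (q_cst hbar f) = \<phi> f"
  using quot_hom.the_elem_coset[OF ext_cas_ideal env_closed(1)] by (simp add: Theta_def flip: q_cst_def)

lemma Theta_q_gen [simp]: "Theta (q_gen hbar g) = Y g"
  using quot_hom.the_elem_coset[OF ext_cas_ideal env_closed(2)] by (simp add: Theta_def flip: q_gen_def)

lemma Theta_q_incl:
  assumes "a \<in> carrier (U_su2 hbar)"
  shows "Theta (q_incl hbar a) = Theta_U hbar a"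
proof -
  have "(Theta \<circ> q_incl hbar) a = Theta_U hbar a"
  proof (rule ring_hom_env_eqI[OF ring_hom_trans[OF _ Theta_hom] Theta_U_hom _ _ assms])
    show "q_incl hbar \<in> Ring.ring_hom (U_su2 hbar) (qalg hbar)"
      unfolding q_incl_def by (rule qi.induced_ring_hom)
  qed (simp_all add: q_incl_def Theta_U_cst Theta_U_gen \<phi>_cst Theta_gen_eq)
  then show ?thesis by simp
qed

text \<open>A ring homomorphism commutes with the expansion in \<open>Fract_eq_sum\<close>, and
  \<open>\<phi>\<close> has the prescribed values at t, r and the constants.\<close>

lemma Theta_subst_eq: "Theta_subst hbar p = \<phi> (Fraction_Field.Fract p 1)"
  by (simp add: Fract_eq_sum \<Theta>e.\<kappa>_sum \<Theta>e.\<kappa>_mult \<Theta>e.\<kappa>_pow \<phi>_cst Theta_subst_def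
      Theta_t_eq Theta_r_eq)

text \<open>A unital homomorphism defined on a field sends nonzero elements to units, so 1/q
  supplies the inverse.\<close>

lemma Theta_subst_inverse:
  assumes "q \<noteq> 0"
  shows "Theta_subst hbar q \<in> Units (Mat4 hbar)"
    "inv\<^bsub>Mat4 hbar\<^esub> (Theta_subst hbar q) = \<phi> (Fraction_Field.Fract 1 q)"
proof -
  have "Fraction_Field.Fract q 1 * Fraction_Field.Fract 1 q = 1"
    using assms by (simp add: One_fract_def eq_fract)
  then have 1: "\<phi> (Fraction_Field.Fract q 1) \<otimes>\<^bsub>Mat4 hbar\<^esub> \<phi> (Fraction_Field.Fract 1 q) = \<one>\<^bsub>Mat4 hbar\<^esub>"
    "\<phi> (Fraction_Field.Fract 1 q) \<otimes>\<^bsub>Mat4 hbar\<^esub> \<phi> (Fraction_Field.Fract q 1) = \<one>\<^bsub>Mat4 hbar\<^esub>"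
    by (metis \<Theta>.\<phi>_1 \<Theta>.\<phi>_mult mult.commute)+
  then show "Theta_subst hbar q \<in> Units (Mat4 hbar)"
    unfolding Theta_subst_eq Units_def by blast
  show "inv\<^bsub>Mat4 hbar\<^esub> (Theta_subst hbar q) = \<phi> (Fraction_Field.Fract 1 q)"
    unfolding Theta_subst_eq using 1 by (intro M.inv_char) simp_all
qed

section \<open>Existence, uniqueness and the two compatibility statements\<close>

lemma is_Theta_Theta: "is_Theta hbar Theta"
  unfolding is_Theta_def
proof (intro conjI allI ballI impI)
  fix p q :: "complex poly poly" assume q: "q \<noteq> 0"
  have "Fraction_Field.Fract p q = Fraction_Field.Fract p 1 * Fraction_Field.Fract 1 q"
    by simp
  then show "Theta (q_cst hbar (Fraction_Field.Fract p q)) =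
      Theta_subst hbar p \<otimes>\<^bsub>Mat4 hbar\<^esub> inv\<^bsub>Mat4 hbar\<^esub> (Theta_subst hbar q)"
    by (simp only: Theta_cst Theta_subst_inverse(2)[OF q] Theta_subst_eq[of p] \<Theta>.\<phi>_mult)
qed (simp_all add: Theta_hom Theta_q_incl Theta_gen_eq Theta_t_eq Theta_r_eq Theta_subst_inverse)

text \<open>All conditions concern values on the carrier only, so they pass to the restriction of a
  solution.\<close>

lemma is_Theta_cong:
  assumes \<Theta>: "is_Theta hbar \<Theta>" and eq: "\<And>a. a \<in> carrier (qalg hbar) \<Longrightarrow> \<Theta>' a = \<Theta> a"
  shows "is_Theta hbar \<Theta>'"
proof -
  have "q_incl hbar a \<in> carrier (qalg hbar)" if "a \<in> carrier (U_su2 hbar)" for a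
    unfolding q_incl_def using that by (rule ring_hom_closed[OF qi.induced_ring_hom])
  moreover have "\<Theta>' \<in> Ring.ring_hom (qalg hbar) (Mat4 hbar)"
    using \<Theta> eq qalg.ring_hom_restrict[of \<Theta> "Mat4 hbar" \<Theta>'] by (simp add: is_Theta_def)
  ultimately show ?thesis
    using \<Theta> by (simp add: is_Theta_def eq)
qed

text \<open>The substitution clause forces the values on all fractions; together with the generators
  these determine a homomorphism.\<close>

lemma is_Theta_unique:
  assumes "is_Theta hbar \<Theta>1" "is_Theta hbar \<Theta>2" "a \<in> carrier (qalg hbar)"
  shows "\<Theta>1 a = \<Theta>2 a"
proof (rule ring_hom_qalg_eqI[where S = "Mat4 hbar", OF _ _ _ _ assms(3)])
  fix f :: ratfun
  obtain p q where "f = Fraction_Field.Fract p q" "q \<noteq> 0" by (cases f)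
  then show "\<Theta>1 (q_cst hbar f) = \<Theta>2 (q_cst hbar f)"
    using assms(1,2) by (simp add: is_Theta_def)
qed (use assms(1,2) in \<open>simp_all add: is_Theta_def\<close>)

text \<open>Membership in \<open>extensional\<close> fixes the values outside the carrier, where
  uniqueness would otherwise fail.\<close>

lemma ex1_Theta: "\<exists>!\<Theta>. \<Theta> \<in> extensional (carrier (qalg hbar)) \<and> is_Theta hbar \<Theta>"
proof (rule ex1I[of _ "restrict Theta (carrier (qalg hbar))"])
  show "restrict Theta (carrier (qalg hbar)) \<in> extensional (carrier (qalg hbar)) \<and>
      is_Theta hbar (restrict Theta (carrier (qalg hbar)))"
    using is_Theta_cong[OF is_Theta_Theta] by simp
  then show "\<Theta> = restrict Theta (carrier (qalg hbar))"
    if "\<Theta> \<in> extensional (carrier (qalg hbar)) \<and> is_Theta hbar \<Theta>" for \<Theta>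
    using that is_Theta_unique by (blast intro: extensionalityI)
qed

text \<open>Scalars are central in the quotient algebra; applying \<open>Theta\<close> to this
  commutation, with \<open>a\<close> embedded there, gives the claim.\<close>

lemma Theta_U_commute:
  assumes "a \<in> carrier (U_su2 hbar)"
  shows "\<phi> f \<otimes>\<^bsub>Mat4 hbar\<^esub> Theta_U hbar a = Theta_U hbar a \<otimes>\<^bsub>Mat4 hbar\<^esub> \<phi> f"
proof -
  have "q_incl hbar a \<in> carrier (qalg hbar)"
    unfolding q_incl_def using assms by (rule ring_hom_closed[OF qi.induced_ring_hom])
  then show ?thesis
    using ring_hom_mult[OF Theta_hom, of "q_cst hbar f" "q_incl hbar a"]
      ring_hom_mult[OF Theta_hom, of "q_incl hbar a" "q_cst hbar f"]
    by (simp add: q_cst_central Theta_q_incl[OF assms])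
qed

text \<open>The Casimir element goes to the Casimir expression in \<open>Y\<close>, which is the
  square of \<Theta>(r) minus hbar^2 by \<open>\<Theta>.\<phi>_r_sq\<close>.\<close>

lemma Theta_U_cas:
  "Theta_U hbar (env_cas (planck hbar)) =
    Theta_r hbar [^]\<^bsub>Mat4 hbar\<^esub> (2::nat) \<ominus>\<^bsub>Mat4 hbar\<^esub> m_cst hbar (hbar ^ 2)"
proof -
  interpret U: ring_hom_ring "U_su2 hbar" "Mat4 hbar" "Theta_U hbar"
    by (rule ring_hom_ringI2[OF env.ring_axioms M.ring_axioms Theta_U_hom])
  let ?C = "Y GX \<otimes>\<^bsub>Mat4 hbar\<^esub> Y GX \<oplus>\<^bsub>Mat4 hbar\<^esub> Y GY \<otimes>\<^bsub>Mat4 hbar\<^esub> Y GY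
    \<oplus>\<^bsub>Mat4 hbar\<^esub> Y GZ \<otimes>\<^bsub>Mat4 hbar\<^esub> Y GZ"
  have "Theta_U hbar (env_cas (planck hbar)) = ?C"
    by (simp add: env_cas_def numeral_2_eq_2 Theta_U_gen Theta_gen_eq)
  moreover have "Theta_r hbar [^]\<^bsub>Mat4 hbar\<^esub> (2::nat) = Z (v * v) \<oplus>\<^bsub>Mat4 hbar\<^esub> ?C"
    unfolding Theta_r_eq \<Theta>.\<phi>_r_sq[symmetric] by (simp add: numeral_2_eq_2 \<Theta>.\<phi>_mult)
  moreover have "m_cst hbar (hbar ^ 2) = Z (v * v)"
    by (simp add: m_cst_eq power2_eq_square rf_cst_mult)
  moreover have "?C = (Z (v * v) \<oplus>\<^bsub>Mat4 hbar\<^esub> ?C) \<ominus>\<^bsub>Mat4 hbar\<^esub> Z (v * v)"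
    by (simp add: M.minus_eq M.a_ac M.r_neg1 M.r_neg2 M.r_neg)
  ultimately show ?thesis by (simp only:)
qed

end

theorem proposition3p1:
  fixes hbar :: complex
  assumes "hbar \<noteq> 0"
  shows
    "(Theta_U hbar \<in> Ring.ring_hom (U_su2 hbar) (Mat4 hbar) \<and>
      (\<forall>c. Theta_U hbar (env_cst (planck hbar) c) = m_cst hbar c) \<and>
      (\<forall>g. Theta_U hbar (env_gen (planck hbar) g) = Theta_gen hbar g)) \<and>
     (\<forall>a \<in> carrier (U_su2 hbar).
        Theta_t hbar \<otimes>\<^bsub>Mat4 hbar\<^esub> Theta_U hbar a = Theta_U hbar a \<otimes>\<^bsub>Mat4 hbar\<^esub> Theta_t hbar \<and>
        Theta_r hbar \<otimes>\<^bsub>Mat4 hbar\<^esub> Theta_U hbar a = Theta_U hbar a \<otimes>\<^bsub>Mat4 hbar\<^esub> Theta_r hbar) \<and>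
     Theta_U hbar (env_cas (planck hbar)) =
       Theta_r hbar [^]\<^bsub>Mat4 hbar\<^esub> (2::nat) \<ominus>\<^bsub>Mat4 hbar\<^esub> m_cst hbar (hbar ^ 2) \<and>
     (\<exists>!\<Theta>. \<Theta> \<in> extensional (carrier (qalg hbar)) \<and> is_Theta hbar \<Theta>)"
proof -
  interpret nonzero_planck hbar by unfold_locales (rule assms)
  show ?thesis
    \<comment> \<open>As \<Theta>(t) and \<Theta>(r) are both values of \<open>\<phi>\<close>, one
      commutation lemma covers them.\<close>
    by (simp add: Theta_U_hom Theta_U_cst Theta_U_gen Theta_t_eq Theta_r_eq Theta_U_commute
        Theta_U_cas[unfolded Theta_r_eq] ex1_Theta)
qed

end
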